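(* Let $f=f(\cdot,\lambda_0)$, $\lambda_0\in S^1$, be a translationally equivariant minimal Lagrangian immersion $\mathbb{C}\to\mathbb{C}P^2$, generated by $D(\lambda)dz$. Then $f$ descends to a torus if and only if (1) the eigenvalues $d_1(\lambda_0)$ and $d_2(\lambda_0)$ have a rational quotient, and (2) either the eigenvalues $d_1(\lambda_0)$ and $d_2(\lambda_0)$ are equal, or $$\frac{1}{2\pi}\,\mathrm{Im}\,\beta_2(2T,\lambda_0)\left\{d_1(\lambda_0)d_2(\lambda_0)+\frac{2\beta}{3}\right\}$$ is rational.
   Context: "$f$ descends to a torus" means that there are two periods $\omega_1,\omega_2\in\mathbb{C}$, linearly independent over $\mathbb{R}$, with $f(z+\omega_i)=f(z)$ for all $z$. $z=x+iy$, $'=d/dy$. Surfaces are assumed not totally geodesic and non-flat. Let $\psi\in\mathbb{C}\setminus\{0\}$ and let $u=u(y)$ be a non-constant real solution of $\frac14u''+e^u-|\psi|^2e^{-2u}=0$ with $u'(0)=0$ and $u(0)=\max u$; $u$ is even and periodic, with smallest period $2T$. Put $a=ie^{u(0)/2}$, $b=i\psi/a^2$, $\beta=2|a|^2+|b|^2$, and $$D(\lambda)=\begin{pmatrix}0&-\lambda\bar b&\lambda^{-1}a\\ \lambda^{-1}b&0&-\lambda\bar a\\ -\lambda\bar a&\lambda^{-1}a&0\end{pmatrix}.$$ For $\lambda\in S^1$ let $id_1(\lambda),id_2(\lambda),id_3(\lambda)$ ($d_j$ real) be the eigenvalues of $D(\lambda)$, i.e. the roots of $\mu^3+\beta\mu-2i\mathrm{Re}(\lambda^{-3}\psi)$;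 the $d_j$ are what the claim calls eigenvalues. Put $$\beta_2(y,\lambda)=\int_0^y\frac{2e^u}{\lambda^3\bar\psi-\lambda^{-3}\psi-e^uu'}ds.$$ The immersion generated by $D(\lambda)dz$ is $f(z,\lambda)=[\mathbb{F}(z,\lambda)e_3]$, where $\mathbb{F}(z,\lambda)\in SU(3)$ is the solution with $\mathbb{F}(0,\lambda)=I$ of $$\mathbb{F}^{-1}\mathbb{F}_z=\lambda^{-1}\begin{pmatrix}0&0&ie^{u/2}\\ -i\psi e^{-u}&0&0\\ 0&ie^{u/2}&0\end{pmatrix}+\mathrm{diag}\left(\tfrac{u_z}{2},-\tfrac{u_z}{2},0\right),\quad \mathbb{F}^{-1}\mathbb{F}_{\bar z}=\lambda\begin{pmatrix}0&-i\bar\psi e^{-u}&0\\ 0&0&ie^{u/2}\\ ie^{u/2}&0&0\end{pmatrix}+\mathrm{diag}\left(-\tfrac{u_{\bar z}}{2},\tfrac{u_{\bar z}}{2},0\right)$$ (equivalently, $\exp(zD(\lambda))=\mathbb{F}U_+$ is an Iwasawa decomposition). It satisfies $f(t+z,\lambda)=e^{tD(\lambda)}f(z,\lambda)$, $t\in\mathbb{R}$. *)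

theory Defs
  imports "HOL-Analysis.Analysis"
begin

section \<open>The conformal factor\<close>

text \<open>
  The induced metric is \<open>2 exp u |dz|\<^sup>2\<close> and \<open>\<psi> dz\<^sup>3\<close> is the (constant) cubic Hopf differential.
  Not totally geodesic means \<open>\<psi> \<noteq> 0\<close>; non-flat means that \<open>u\<close> is not constant.
\<close>

definition tzitzeica_profile :: "complex \<Rightarrow> (real \<Rightarrow> real) \<Rightarrow> bool" where
  "tzitzeica_profile \<psi> u \<longleftrightarrow>
     (\<forall>y. u field_differentiable (at y)) \<and>
     (\<forall>y. deriv u field_differentiable (at y)) \<and>
     (\<forall>y. 1/4 * deriv (deriv u) y + exp (u y) - (cmod \<psi>)\<^sup>2 * exp (- 2 * u y) = 0) \<and>
     \<not> (u constant_on UNIV) \<and>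
     deriv u 0 = 0 \<and> (\<forall>y. u y \<le> u 0)"

definition smallest_period :: "(real \<Rightarrow> real) \<Rightarrow> real \<Rightarrow> bool" where
  "smallest_period u P \<longleftrightarrow>
     P > 0 \<and> (\<forall>y. u (y + P) = u y) \<and> (\<forall>Q>0. (\<forall>y. u (y + Q) = u y) \<longrightarrow> P \<le> Q)"

section \<open>The potential\<close>

definition coeff_a :: "(real \<Rightarrow> real) \<Rightarrow> complex" where
  "coeff_a u = \<i> * of_real (exp (u 0 / 2))"

definition coeff_b :: "complex \<Rightarrow> (real \<Rightarrow> real) \<Rightarrow> complex" where
  "coeff_b \<psi> u = \<i> * \<psi> / (coeff_a u)\<^sup>2"

definition coeff_beta :: "complex \<Rightarrow> (real \<Rightarrow> real) \<Rightarrow> real" where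
  "coeff_beta \<psi> u = 2 * (cmod (coeff_a u))\<^sup>2 + (cmod (coeff_b \<psi> u))\<^sup>2"

definition potential :: "complex \<Rightarrow> (real \<Rightarrow> real) \<Rightarrow> complex \<Rightarrow> complex^3^3" where
  "potential \<psi> u l = (let a = coeff_a u; b = coeff_b \<psi> u in
     vector [vector [0, - l * cnj b, a / l],
             vector [b / l, 0, - l * cnj a],
             vector [- l * cnj a, a / l, 0]])"

text \<open>
  \<open>\<i> d\<^sub>1, \<i> d\<^sub>2, \<i> d\<^sub>3\<close> are the eigenvalues of \<open>A\<close>, listed with algebraic multiplicity, in any order.
\<close>

definition imaginary_spectrum :: "complex^3^3 \<Rightarrow> real \<Rightarrow> real \<Rightarrow> real \<Rightarrow> bool" where
  "imaginary_spectrum A d1 d2 d3 \<longleftrightarrow>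
     (\<forall>\<mu>. det (mat \<mu> - A) =
        (\<mu> - \<i> * of_real d1) * (\<mu> - \<i> * of_real d2) * (\<mu> - \<i> * of_real d3))"

text \<open>
  If \<open>\<psi> / l\<^sup>3\<close> is not real, the denominator never vanishes and the integrand is continuous.
  If \<open>\<psi> / l\<^sup>3\<close> is real, the integrand is \<open>- 2 / u'\<close>, which is not integrable at the zeros of
  \<open>u'\<close>; the library's value for the integral over a full period is then 0.
\<close>

definition beta2 :: "complex \<Rightarrow> (real \<Rightarrow> real) \<Rightarrow> real \<Rightarrow> complex \<Rightarrow> complex" where
  "beta2 \<psi> u y l =
     (LBINT s=0..y. 2 * of_real (exp (u s)) /
        (l ^ 3 * cnj \<psi> - \<psi> / l ^ 3 - of_real (exp (u s) * deriv u s)))"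

section \<open>The immersion\<close>

text \<open>The Wirtinger derivatives \<open>\<partial>/\<partial>z\<close> and its conjugate, for real-differentiable functions.\<close>

definition d_z :: "(complex \<Rightarrow> complex) \<Rightarrow> complex \<Rightarrow> complex" where
  "d_z g z = (frechet_derivative g (at z) 1 - \<i> * frechet_derivative g (at z) \<i>) / 2"

definition d_zbar :: "(complex \<Rightarrow> complex) \<Rightarrow> complex \<Rightarrow> complex" where
  "d_zbar g z = (frechet_derivative g (at z) 1 + \<i> * frechet_derivative g (at z) \<i>) / 2"

definition SU3 :: "(complex^3^3) set" where
  "SU3 = {A. map_matrix cnj (transpose A) ** A = mat 1 \<and> det A = 1}"

definition lax_U :: "complex \<Rightarrow> (real \<Rightarrow> real) \<Rightarrow> complex \<Rightarrow> complex \<Rightarrow> complex^3^3" where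
  "lax_U \<psi> u l z = (let v = u (Im z); p = d_z (\<lambda>w. of_real (u (Im w))) z in
     vector [vector [p / 2, 0, \<i> * of_real (exp (v / 2)) / l],
             vector [- \<i> * \<psi> * of_real (exp (- v)) / l, - p / 2, 0],
             vector [0, \<i> * of_real (exp (v / 2)) / l, 0]])"

definition lax_V :: "complex \<Rightarrow> (real \<Rightarrow> real) \<Rightarrow> complex \<Rightarrow> complex \<Rightarrow> complex^3^3" where
  "lax_V \<psi> u l z = (let v = u (Im z); q = d_zbar (\<lambda>w. of_real (u (Im w))) z in
     vector [vector [- q / 2, - \<i> * l * cnj \<psi> * of_real (exp (- v)), 0],
             vector [0, q / 2, \<i> * l * of_real (exp (v / 2))],
             vector [\<i> * l * of_real (exp (v / 2)), 0, 0]])"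

definition extended_frame ::
  "complex \<Rightarrow> (real \<Rightarrow> real) \<Rightarrow> complex \<Rightarrow> (complex \<Rightarrow> complex^3^3) \<Rightarrow> bool" where
  "extended_frame \<psi> u l F \<longleftrightarrow>
     F 0 = mat 1 \<and>
     (\<forall>z. F z \<in> SU3) \<and>
     (\<forall>z. F differentiable (at z)) \<and>
     (\<forall>z. matrix_inv (F z) ** (\<chi> i j. d_z (\<lambda>w. F w $ i $ j) z) = lax_U \<psi> u l z) \<and>
     (\<forall>z. matrix_inv (F z) ** (\<chi> i j. d_zbar (\<lambda>w. F w $ i $ j) z) = lax_V \<psi> u l z)"

text \<open>
  The point \<open>[v]\<close> of the complex projective plane, as the complex line spanned by \<open>v \<noteq> 0\<close>
  (the span is over the complex numbers).
\<close>

definition proj_point :: "complex^3 \<Rightarrow> (complex^3) set" where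
  "proj_point v = vec.span {v}"

definition immersion_of :: "(complex \<Rightarrow> complex^3^3) \<Rightarrow> complex \<Rightarrow> (complex^3) set" where
  "immersion_of F z = proj_point (F z *v axis 3 1)"

definition descends_to_torus :: "(complex \<Rightarrow> 'a) \<Rightarrow> bool" where
  "descends_to_torus f \<longleftrightarrow>
     (\<exists>\<omega>1 \<omega>2. \<omega>1 \<noteq> \<omega>2 \<and> independent {\<omega>1, \<omega>2} \<and>
        (\<forall>z. f (z + \<omega>1) = f z) \<and> (\<forall>z. f (z + \<omega>2) = f z))"

end

theory Submission
  imports Defs
begin

text \<open>
  Write \<open>z = x + i y\<close>. After multiplication by a diagonal gauge, each row of the extended frame becomes
  a triple \<open>(p, q, s)\<close> that solves a linear system in \<open>x\<close> and \<open>y\<close>; its coefficients depend on \<open>y\<close> alone, and on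
  \<open>\<psi>\<close> and \<open>l\<close> only through \<open>\<kappa> = \<psi> / l\<^sup>3\<close>. The third entry \<open>s\<close> is the entry of the row in the column that
  defines the immersion. A positive definite Hermitian form is constant along solutions
  (\<open>pairing_constant\<close>), so a solution is determined by its value at \<open>0\<close>. The matrix of the \<open>x\<close>-part, which at
  \<open>y = 0\<close> is the potential in the new gauge, maps solutions to solutions. Hence a solution that starts in the eigenspace
  for \<open>i d\<^sub>j\<close> stays in it, and then \<open>s\<^sub>j(x + i y) = exp(i d\<^sub>j x) s\<^sub>j(i y)\<close>. The eigenvalues are distinct
  (\<open>no_double_root\<close>, where non-constancy of \<open>u\<close> enters), so there are three such solutions and
  \<open>(s\<^sub>1 : s\<^sub>2 : s\<^sub>3)\<close> are homogeneous coordinates of the immersion.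

  The eigensolutions are mutually orthogonal. Therefore the sums \<open>\<Sum>\<bar>s\<^sub>j\<bar>\<^sup>2\<close> and \<open>\<Sum>d\<^sub>j\<^sup>2 \<bar>s\<^sub>j\<bar>\<^sup>2\<close>, with each
  solution normalised to length one, equal \<open>1\<close> and \<open>2 exp u\<close>, their quotient depends on the projective point only, and the imaginary part of a
  period of the immersion has to be a period of \<open>u\<close>, that is \<open>2 T k\<close> with an integer \<open>k\<close>. The translation by
  \<open>2 T i\<close> multiplies \<open>s\<^sub>j\<close> by a number \<open>exp(i \<theta>\<^sub>j)\<close>. Since all \<open>s\<^sub>j\<close> are non-zero at some common point,
  \<open>a + 2 T k i\<close> is a period if and only if the three numbers \<open>d\<^sub>j a + k \<theta>\<^sub>j\<close> agree modulo \<open>2 \<pi>\<close>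
  (\<open>line_period_iff\<close>). What remains is arithmetic: these \<open>(a, k)\<close> form a lattice of rank two if and only if
  \<open>r = (d\<^sub>1 - d\<^sub>3) / (d\<^sub>2 - d\<^sub>3)\<close> is rational and \<open>(\<theta>\<^sub>1 - \<theta>\<^sub>3) - r (\<theta>\<^sub>2 - \<theta>\<^sub>3)\<close> is a rational multiple of \<open>2 \<pi>\<close>
  (\<open>rank_two_period_lattice_iff\<close>). As the \<open>d\<^sub>j\<close> add up to zero, the first condition says that \<open>d\<^sub>1 / d\<^sub>2\<close> is rational.

  The phases \<open>\<theta>\<^sub>j\<close> are found in two ways. If \<open>\<kappa>\<close> is not real, eliminating \<open>p\<close> and \<open>q\<close> from the eigenvalue
  equations gives \<open>s\<^sub>j' = g\<^sub>j s\<^sub>j\<close>, where \<open>g\<^sub>j\<close> is the conjugate integrand of \<open>\<beta>\<^sub>2\<close> times a quadratic polynomial in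
  \<open>d\<^sub>j\<close> with leading coefficient \<open>- 1\<close>. In the combination above the constant and the linear terms of the
  polynomial cancel, and it becomes \<open>(d\<^sub>1 - d\<^sub>2)(d\<^sub>1 - d\<^sub>3) Im \<beta>\<^sub>2\<close>. Divided by \<open>2 \<pi>\<close>, this differs from the number in the theorem
  by the factor \<open>3 (r - 1)\<close>, because \<open>d\<^sub>1 d\<^sub>2 + 2 \<beta> / 3 = (d\<^sub>1 - d\<^sub>3)(d\<^sub>2 - d\<^sub>3) / 3\<close>. If \<open>\<kappa>\<close> is real, the system along the
  \<open>y\<close>-axis is real, so every \<open>exp(i \<theta>\<^sub>j)\<close> is \<open>1\<close> or \<open>- 1\<close>; at the same time the integrand of \<open>\<beta>\<^sub>2\<close> is real, so
  \<open>Im \<beta>\<^sub>2 = 0\<close>. For rational \<open>r\<close> both forms of the second condition then hold.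
\<close>

section \<open>Linear algebra and lattice arithmetic\<close>

text \<open>
  A square matrix whose rows are orthogonal for the weighted form has an explicit right inverse; that
  it is also a left inverse is orthogonality of the columns.
\<close>

lemma weighted_orthogonal_rows:
  fixes A :: "complex^'n^'n" and c n :: "'n \<Rightarrow> complex"
  assumes orth: "\<And>i j. (\<Sum>a\<in>UNIV. c a * A$i$a * cnj (A$j$a)) = (if i = j then n i else 0)"
    and n: "\<And>i. n i \<noteq> 0"
  shows "c a * (\<Sum>i\<in>UNIV. cnj (A$i$a) * A$i$b / n i) = (if a = b then 1 else 0)"
proof -
  define B :: "complex^'n^'n" where "B = (\<chi> a i. c a * cnj (A$i$a) / n i)"
  have "(A ** B)$i$j = (mat 1 :: complex^'n^'n)$i$j" for i j
  proof -
    have "(A ** B)$i$j = (\<Sum>a\<in>UNIV. c a * A$i$a * cnj (A$j$a)) / n j"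
      by (simp add: matrix_matrix_mult_def B_def sum_divide_distrib mult_ac)
    thus ?thesis using n by (simp add: orth mat_def)
  qed
  hence "A ** B = mat 1" by (simp add: vec_eq_iff)
  hence "B ** A = mat 1" using matrix_left_right_inverse by blast
  hence "(B ** A)$a$b = (if a = b then 1 else 0)" by (simp add: mat_def)
  thus ?thesis by (simp add: matrix_matrix_mult_def B_def sum_distrib_left mult_ac)
qed

lemma independent_complex_pair_iff:
  "\<omega>1 \<noteq> \<omega>2 \<and> independent {\<omega>1, \<omega>2} \<longleftrightarrow> Re \<omega>1 * Im \<omega>2 \<noteq> Re \<omega>2 * Im \<omega>1"
proof -
  have "\<omega>1 \<noteq> \<omega>2 \<and> independent {\<omega>1, \<omega>2} \<longleftrightarrow> \<omega>1 \<noteq> \<omega>2 \<and> \<omega>2 \<noteq> 0 \<and> (\<forall>k. \<omega>1 \<noteq> k *\<^sub>R \<omega>2)"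
    by (auto simp: independent_insert span_singleton)
  also have "\<dots> \<longleftrightarrow> \<omega>2 \<noteq> 0 \<and> (\<forall>k. \<omega>1 \<noteq> k *\<^sub>R \<omega>2)"
    by (metis scaleR_one)
  also have "\<dots> \<longleftrightarrow> Re \<omega>1 * Im \<omega>2 \<noteq> Re \<omega>2 * Im \<omega>1"
  proof -
    have "\<exists>k. \<omega>1 = k *\<^sub>R \<omega>2" if "Re \<omega>1 * Im \<omega>2 = Re \<omega>2 * Im \<omega>1" "\<omega>2 \<noteq> 0"
    proof (cases "Re \<omega>2 = 0")
      case True
      with that have "\<omega>1 = (Im \<omega>1 / Im \<omega>2) *\<^sub>R \<omega>2" by (auto simp: complex_eq_iff)
      thus ?thesis by blast
    next
      case False
      with that have "\<omega>1 = (Re \<omega>1 / Re \<omega>2) *\<^sub>R \<omega>2" by (auto simp: complex_eq_iff field_simps)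
      thus ?thesis by blast
    qed
    thus ?thesis by auto
  qed
  finally show ?thesis .
qed

text \<open>
  Combining two independent pairs so that the integer component cancels leaves a pair \<open>(a, 0)\<close> with
  \<open>a \<noteq> 0\<close>, which makes \<open>\<delta>1\<close> and \<open>\<delta>2\<close> commensurable; eliminating \<open>a\<close> from a pair with non-zero integer component
  gives the condition on \<open>\<phi>1\<close> and \<open>\<phi>2\<close>. Conversely, clearing denominators in the two rational numbers gives one
  pair \<open>(a, 0)\<close> and one with non-zero integer component.
\<close>

lemma rank_two_period_lattice_iff:
  fixes \<delta>1 \<delta>2 \<phi>1 \<phi>2 :: real
  defines "per a n \<equiv> (\<exists>j::int. \<delta>1 * a + of_int n * \<phi>1 = 2 * pi * of_int j) \<and>
                     (\<exists>j::int. \<delta>2 * a + of_int n * \<phi>2 = 2 * pi * of_int j)"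
  assumes \<delta>: "\<delta>1 \<noteq> 0" "\<delta>2 \<noteq> 0"
  shows "(\<exists>a1 n1 a2 n2. a1 * of_int n2 \<noteq> a2 * of_int n1 \<and> per a1 n1 \<and> per a2 n2) \<longleftrightarrow>
     \<delta>1 / \<delta>2 \<in> \<rat> \<and> (\<phi>1 - \<delta>1 / \<delta>2 * \<phi>2) / (2 * pi) \<in> \<rat>"
proof
  assume "\<exists>a1 n1 a2 n2. a1 * of_int n2 \<noteq> a2 * of_int n1 \<and> per a1 n1 \<and> per a2 n2"
  then obtain a1 a2 n1 n2 where ind: "a1 * of_int n2 \<noteq> a2 * of_int n1" and
    per: "per a1 n1" "per a2 n2" by blast
  obtain i j :: int where 1: "\<delta>1 * a1 + of_int n1 * \<phi>1 = 2 * pi * of_int i"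
    "\<delta>2 * a1 + of_int n1 * \<phi>2 = 2 * pi * of_int j" using per(1) unfolding per_def by blast
  obtain i' j' :: int where 2: "\<delta>1 * a2 + of_int n2 * \<phi>1 = 2 * pi * of_int i'"
    "\<delta>2 * a2 + of_int n2 * \<phi>2 = 2 * pi * of_int j'" using per(2) unfolding per_def by blast
  \<comment> \<open>The combination of the two periods without integer component.\<close>
  define a where "a = a1 * of_int n2 - a2 * of_int n1"
  have a: "a \<noteq> 0" using ind by (simp add: a_def)
  have "\<delta>1 * a = of_int n2 * (\<delta>1 * a1 + of_int n1 * \<phi>1) - of_int n1 * (\<delta>1 * a2 + of_int n2 * \<phi>1)"
    by (simp add: a_def algebra_simps)
  hence e1: "\<delta>1 * a = 2 * pi * of_int (n2 * i - n1 * i')" unfolding 1 2 by (simp add: algebra_simps)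
  have "\<delta>2 * a = of_int n2 * (\<delta>2 * a1 + of_int n1 * \<phi>2) - of_int n1 * (\<delta>2 * a2 + of_int n2 * \<phi>2)"
    by (simp add: a_def algebra_simps)
  hence e2: "\<delta>2 * a = 2 * pi * of_int (n2 * j - n1 * j')" unfolding 1 2 by (simp add: algebra_simps)
  have "\<delta>1 / \<delta>2 = (\<delta>1 * a) / (\<delta>2 * a)" using a by simp
  also have "\<dots> = of_int (n2 * i - n1 * i') / of_int (n2 * j - n1 * j')"
    unfolding e1 e2 by (simp del: of_int_diff of_int_mult)
  finally have \<rho>: "\<delta>1 / \<delta>2 \<in> \<rat>" by (simp del: of_int_diff of_int_mult)
  have key: "(\<phi>1 - \<delta>1 / \<delta>2 * \<phi>2) / (2 * pi) = (of_int i - \<delta>1 / \<delta>2 * of_int j) / of_int n"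
    if "n \<noteq> 0" "\<delta>1 * a + of_int n * \<phi>1 = 2 * pi * of_int i"
       "\<delta>2 * a + of_int n * \<phi>2 = 2 * pi * of_int j" for n i j :: int and a
  proof -
    have "of_int n * (\<phi>1 - \<delta>1 / \<delta>2 * \<phi>2) =
       (\<delta>1 * a + of_int n * \<phi>1) - \<delta>1 / \<delta>2 * (\<delta>2 * a + of_int n * \<phi>2)"
      using \<delta> by (simp add: field_simps)
    also have "\<dots> = 2 * pi * (of_int i - \<delta>1 / \<delta>2 * of_int j)"
      unfolding that by (simp add: algebra_simps)
    finally show ?thesis using that(1) by (simp add: divide_eq_eq eq_divide_eq mult_ac)
  qed
  have "n1 \<noteq> 0 \<or> n2 \<noteq> 0" using ind by auto
  hence "(\<phi>1 - \<delta>1 / \<delta>2 * \<phi>2) / (2 * pi) \<in> \<rat>"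
    using key[OF _ 1] key[OF _ 2] \<rho> by (metis Rats_diff Rats_divide Rats_mult Rats_of_int)
  with \<rho> show "\<delta>1 / \<delta>2 \<in> \<rat> \<and> (\<phi>1 - \<delta>1 / \<delta>2 * \<phi>2) / (2 * pi) \<in> \<rat>" ..
next
  assume *: "\<delta>1 / \<delta>2 \<in> \<rat> \<and> (\<phi>1 - \<delta>1 / \<delta>2 * \<phi>2) / (2 * pi) \<in> \<rat>"
  obtain r1 r2 :: int where r: "r2 \<noteq> 0" "\<delta>1 / \<delta>2 = of_int r1 / of_int r2"
    using * by (metis Rats_cases' less_numeral_extra(3))
  obtain s1 s2 :: int where s: "s2 \<noteq> 0" "(\<phi>1 - \<delta>1 / \<delta>2 * \<phi>2) / (2 * pi) = of_int s1 / of_int s2"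
    using * by (metis Rats_cases' less_numeral_extra(3))
  define a where "a = 2 * pi * of_int r2 / \<delta>2"
  have "\<delta>1 * a = 2 * pi * of_int r1"
    using r \<delta> by (simp add: a_def field_simps)
  moreover have "\<delta>2 * a = 2 * pi * of_int r2"
    using \<delta> by (simp add: a_def)
  ultimately have p1: "per a 0" unfolding per_def by auto
  \<comment> \<open>Chosen so that the second congruence holds with integer \<open>0\<close>.\<close>
  define b where "b = - of_int s2 * \<phi>2 / \<delta>2"
  have "\<delta>1 * b + of_int s2 * \<phi>1 = of_int s2 * (\<phi>1 - \<delta>1 / \<delta>2 * \<phi>2)"
    using \<delta> by (simp add: b_def field_simps)
  also have "\<dots> = 2 * pi * of_int s1" using s by (simp add: field_simps)
  finally have "\<delta>1 * b + of_int s2 * \<phi>1 = 2 * pi * of_int s1" .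
  moreover have "\<delta>2 * b + of_int s2 * \<phi>2 = 2 * pi * of_int 0"
    using \<delta> by (simp add: b_def)
  ultimately have p2: "per b s2" unfolding per_def by blast
  have "a * of_int s2 \<noteq> b * of_int 0" using s(1) r(1) \<delta> by (simp add: a_def)
  with p1 p2 show "\<exists>a1 n1 a2 n2. a1 * of_int n2 \<noteq> a2 * of_int n1 \<and> per a1 n1 \<and> per a2 n2"
    by blast
qed

text \<open>
  With \<open>r = d1 / d2\<close> the difference quotient is the Moebius image \<open>2 - 3 / (r + 2)\<close>. When \<open>d2 = 0\<close>, the
  quotient \<open>d1 / d2\<close> is \<open>0\<close> by convention and the difference quotient is \<open>2\<close>, so that both sides hold.
\<close>

lemma ratio_rational_iff_difference_ratio_rational:
  fixes d1 d2 d3 :: real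
  assumes "d1 + d2 + d3 = 0" "d2 \<noteq> d3"
  shows "d1 / d2 \<in> \<rat> \<longleftrightarrow> (d1 - d3) / (d2 - d3) \<in> \<rat>"
proof (cases "d2 = 0")
  case True
  with assms have "d3 = - d1" "d1 \<noteq> 0" by auto
  with True show ?thesis by (simp add: Rats_number_of)
next
  case False
  define r where "r = d1 / d2"
  have d1: "d1 = r * d2" using False by (simp add: r_def)
  have "d3 = - d1 - d2" using assms(1) by linarith
  hence d3: "d3 = - (r + 1) * d2" by (simp add: d1 algebra_simps)
  have "r + 2 \<noteq> 0"
  proof
    assume "r + 2 = 0"
    hence "r = -2" by simp
    with d3 assms(2) show False by simp
  qed
  have "(d1 - d3) / (d2 - d3) = (d2 * (2 * r + 1)) / (d2 * (r + 2))"
    unfolding d1 d3 by (simp add: algebra_simps)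
  also have "\<dots> = (2 * r + 1) / (r + 2)" using False by (rule mult_divide_mult_cancel_left)
  also have "\<dots> = 2 - 3 / (r + 2)" using \<open>r + 2 \<noteq> 0\<close> by (simp add: divide_simps)
  finally have *: "(d1 - d3) / (d2 - d3) = 2 - 3 / (r + 2)" .
  have "r = 3 / (2 - (2 - 3 / (r + 2))) - 2" using \<open>r + 2 \<noteq> 0\<close> by (simp add: field_simps)
  hence "r \<in> \<rat>" if "2 - 3 / (r + 2) \<in> \<rat>"
    using that by (metis Rats_diff Rats_divide Rats_number_of)
  moreover have "2 - 3 / (r + 2) \<in> \<rat>" if "r \<in> \<rat>"
    using that by (intro Rats_diff Rats_divide Rats_add Rats_number_of)
  ultimately show ?thesis unfolding * r_def[symmetric] by blast
qed
lemma proj_point_eq_iff: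
  assumes "v \<noteq> 0" "w \<noteq> 0"
  shows "proj_point v = proj_point w \<longleftrightarrow> (\<exists>c. c \<noteq> 0 \<and> v = c *s w)"
proof
  assume "proj_point v = proj_point w"
  hence "v \<in> vec.span {w}" unfolding proj_point_def using vec.span_base[of v "{v}"] by blast
  then obtain c where "v = c *s w" by (auto simp: vec.span_singleton)
  with assms(1) show "\<exists>c. c \<noteq> 0 \<and> v = c *s w" by (auto intro!: exI[of _ c])
next
  assume "\<exists>c. c \<noteq> 0 \<and> v = c *s w"
  then obtain c where c: "c \<noteq> 0" "v = c *s w" by blast
  hence "w = inverse c *s v" by simp
  show "proj_point v = proj_point w" unfolding proj_point_def
  proof (rule vec.span_eq[THEN iffD2], intro conjI)
    show "{v} \<subseteq> vec.span {w}" unfolding c(2) by (simp add: vec.span_scale vec.span_base)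
    show "{w} \<subseteq> vec.span {v}"
      by (subst \<open>w = inverse c *s v\<close>) (simp add: vec.span_scale vec.span_base)
  qed
qed

lemma cis_eq_iff: "cis a = cis b \<longleftrightarrow> (\<exists>j::int. a - b = 2 * pi * of_int j)"
proof -
  have "cis a = cis b \<longleftrightarrow> cis (a - b) = 1"
    by (simp add: cis_divide[symmetric])
  also have "\<dots> \<longleftrightarrow> exp (\<i> * of_real (a - b)) = 1" by (simp only: cis_conv_exp)
  also have "\<dots> \<longleftrightarrow> (\<exists>j::int. a - b = 2 * pi * of_int j)"
    unfolding exp_eq_1 by (auto simp: mult_ac)
  finally show ?thesis .
qed

section \<open>Derivatives along horizontal and vertical lines\<close>

lemma constant_of_partial_derivatives:
  fixes g :: "real \<Rightarrow> real \<Rightarrow> complex"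
  assumes "\<And>x y. ((\<lambda>t. g t y) has_vector_derivative 0) (at x)"
    and "\<And>x y. ((\<lambda>t. g x t) has_vector_derivative 0) (at y)"
  shows "g x y = g 0 0"
proof -
  have "g x y = g 0 y"
    using has_vector_derivative_zero_constant[of UNIV "\<lambda>t. g t y"] assms(1) by force
  also have "\<dots> = g 0 0"
    using has_vector_derivative_zero_constant[of UNIV "\<lambda>t. g 0 t"] assms(2) by force
  finally show ?thesis .
qed

lemma has_vector_derivative_compose_real:
  assumes "(f has_vector_derivative f') (at (g x))" "(g has_real_derivative g') (at x)"
  shows "((\<lambda>t. f (g t)) has_vector_derivative g' *\<^sub>R f') (at x)"
  using vector_diff_chain_at[of g g' x f f'] assms
  by (simp add: o_def has_real_derivative_iff_has_vector_derivative)

text \<open>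
  The Wirtinger derivatives are the data of the Lax pair, while the argument uses derivatives along horizontal and
  vertical lines.
\<close>

lemma line_derivatives:
  fixes g :: "complex \<Rightarrow> complex"
  assumes "g differentiable (at (Complex x y))"
  shows "((\<lambda>t. g (Complex t y)) has_vector_derivative d_z g (Complex x y) + d_zbar g (Complex x y)) (at x)"
    and "((\<lambda>t. g (Complex x t)) has_vector_derivative \<i> * (d_z g (Complex x y) - d_zbar g (Complex x y))) (at y)"
proof -
  let ?f = "frechet_derivative g (at (Complex x y))"
  have g: "(g has_derivative ?f) (at (Complex x y))"
    using assms frechet_derivative_works by blast
  have lin: "?f (h *\<^sub>R v) = h *\<^sub>R ?f v" for h v
    using has_derivative_linear[OF g] linear_cmul by blast
  have "((\<lambda>t. Complex t y) has_vector_derivative 1) (at x)"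
    unfolding Complex_eq
    by (rule has_vector_derivative_eq_rhs, (rule has_vector_derivative_add has_vector_derivative_const
        has_vector_derivative_of_real[OF DERIV_ident])+) simp
  hence "((\<lambda>t. Complex t y) has_derivative (\<lambda>h. h *\<^sub>R 1)) (at x)" by (simp add: has_vector_derivative_def)
  from has_derivative_compose[OF this g] 
  have "((\<lambda>t. g (Complex t y)) has_vector_derivative ?f 1) (at x)"
    by (simp only: has_vector_derivative_def lin)
  thus "((\<lambda>t. g (Complex t y)) has_vector_derivative d_z g (Complex x y) + d_zbar g (Complex x y)) (at x)"
    by (simp add: d_z_def d_zbar_def add_divide_distrib[symmetric])
  have "((\<lambda>t. Complex x t) has_vector_derivative \<i>) (at y)"
    unfolding Complex_eq
    by (rule has_vector_derivative_eq_rhs, (rule has_vector_derivative_add has_vector_derivative_mult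
        has_vector_derivative_const has_vector_derivative_of_real[OF DERIV_ident])+) simp
  hence "((\<lambda>t. Complex x t) has_derivative (\<lambda>h. h *\<^sub>R \<i>)) (at y)" by (simp add: has_vector_derivative_def)
  from has_derivative_compose[OF this g] 
  have "((\<lambda>t. g (Complex x t)) has_vector_derivative ?f \<i>) (at y)"
    by (simp only: has_vector_derivative_def lin)
  thus "((\<lambda>t. g (Complex x t)) has_vector_derivative \<i> * (d_z g (Complex x y) - d_zbar g (Complex x y))) (at y)"
    by (simp add: d_z_def d_zbar_def diff_divide_distrib[symmetric] algebra_simps)
qed

section \<open>The conformal factor\<close>

locale tzitzeica_surface =
  fixes \<psi> l :: complex and u :: "real \<Rightarrow> real"
  assumes profile: "tzitzeica_profile \<psi> u"
    and l_unimodular: "cmod l = 1"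
begin

definition \<kappa> :: complex where "\<kappa> = \<psi> / l ^ 3"

text \<open>
  The derivatives of \<open>V\<close>, its inverse \<open>Vi\<close> and \<open>E\<close> are polynomials in the three functions. Treating them as
  independent quantities with the single relation \<open>V Vi = 1\<close> turns all computations below into
  polynomial identities.
\<close>

definition V :: "real \<Rightarrow> complex" where "V y = of_real (exp (u y))"
definition Vi :: "real \<Rightarrow> complex" where "Vi y = of_real (exp (- u y))"
definition E :: "real \<Rightarrow> complex" where "E y = of_real (deriv u y / 2)"

lemma V_Vi: "V y * Vi y = 1"
  by (simp add: V_def Vi_def exp_minus)

lemma V_nonzero [simp]: "V y \<noteq> 0" by (simp add: V_def)

lemma cnj_coeffs [simp]: "cnj (V y) = V y" "cnj (Vi y) = Vi y" "cnj (E y) = E y"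
  by (simp_all add: V_def Vi_def E_def)

lemma l_nonzero [simp]: "l \<noteq> 0" using l_unimodular by auto

lemma cnj_l: "cnj l = 1 / l"
  using l_unimodular by (metis complex_div_cnj div_by_1 mult_1 of_real_1 power_one)

lemma cnj_\<kappa>: "cnj \<kappa> = l ^ 3 * cnj \<psi>"
  by (simp add: \<kappa>_def cnj_l power_one_over)

lemma cmod_\<kappa>: "cmod \<kappa> = cmod \<psi>"
  by (simp add: \<kappa>_def norm_divide norm_power l_unimodular)

lemma \<kappa>_cnj: "\<kappa> * cnj \<kappa> = of_real ((cmod \<psi>)\<^sup>2)"
  using complex_norm_square[of \<kappa>] by (simp add: cmod_\<kappa>)

lemma u_deriv: "(u has_real_derivative deriv u y) (at y)"
  using profile DERIV_deriv_iff_field_differentiable by (auto simp: tzitzeica_profile_def)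

lemma u'_deriv: "(deriv u has_real_derivative
    (4 * (cmod \<psi>)\<^sup>2 * exp (- 2 * u y) - 4 * exp (u y))) (at y)"
proof -
  have *: "1/4 * deriv (deriv u) y + exp (u y) - (cmod \<psi>)\<^sup>2 * exp (- 2 * u y) = 0"
    using profile by (auto simp: tzitzeica_profile_def)
  have "deriv (deriv u) y = 4 * (cmod \<psi>)\<^sup>2 * exp (- 2 * u y) - 4 * exp (u y)"
    using * by linarith
  moreover have "(deriv u has_real_derivative deriv (deriv u) y) (at y)"
    using profile DERIV_deriv_iff_field_differentiable by (auto simp: tzitzeica_profile_def)
  ultimately show ?thesis by simp
qed

lemma V_deriv: "(V has_vector_derivative 2 * E y * V y) (at y)"
proof -
  have "((\<lambda>y. exp (u y)) has_real_derivative exp (u y) * deriv u y) (at y)"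
    by (auto intro!: derivative_eq_intros u_deriv)
  from has_vector_derivative_of_real[OF this]
  show ?thesis unfolding V_def[abs_def] E_def by (simp add: mult.commute)
qed

lemma Vi_deriv: "(Vi has_vector_derivative - 2 * E y * Vi y) (at y)"
proof -
  have "((\<lambda>y. exp (- u y)) has_real_derivative exp (- u y) * (- deriv u y)) (at y)"
    by (auto intro!: derivative_eq_intros u_deriv)
  from has_vector_derivative_of_real[OF this]
  show ?thesis unfolding Vi_def[abs_def] E_def by (simp add: mult.commute)
qed

lemma E_deriv: "(E has_vector_derivative (2 * \<kappa> * cnj \<kappa> * (Vi y)\<^sup>2 - 2 * V y)) (at y)"
proof -
  have "((\<lambda>y. deriv u y / 2) has_real_derivative
      (4 * (cmod \<psi>)\<^sup>2 * exp (- 2 * u y) - 4 * exp (u y)) / 2) (at y)"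
    by (auto intro!: derivative_eq_intros u'_deriv)
  from has_vector_derivative_of_real[OF this]
  have "(E has_vector_derivative
      of_real ((4 * (cmod \<psi>)\<^sup>2 * exp (- 2 * u y) - 4 * exp (u y)) / 2)) (at y)"
    unfolding E_def[abs_def] .
  also have "of_real ((4 * (cmod \<psi>)\<^sup>2 * exp (- 2 * u y) - 4 * exp (u y)) / 2) =
     2 * \<kappa> * cnj \<kappa> * (Vi y)\<^sup>2 - 2 * V y"
    by (simp add: mult.assoc \<kappa>_cnj V_def Vi_def exp_of_real[symmetric] exp_double[symmetric] field_simps del: exp_of_real)
  finally show ?thesis .
qed

end

section \<open>Gauged rows of the frame\<close>

context tzitzeica_surface
begin

text \<open>
  The system satisfied by a row \<open>(w\<^sub>1, w\<^sub>2, w\<^sub>3)\<close> of the extended frame in the gauge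
  \<open>p = exp(u/2) w\<^sub>1 / l\<close>, \<open>q = l exp(u/2) w\<^sub>2\<close>, \<open>s = w\<^sub>3\<close>. This gauge removes \<open>l\<close> in favour of \<open>\<kappa>\<close> and makes the
  system real along the \<open>y\<close>-axis when \<open>\<kappa>\<close> is real.
\<close>

definition frame_row ::
  "(real \<Rightarrow> real \<Rightarrow> complex) \<Rightarrow> (real \<Rightarrow> real \<Rightarrow> complex) \<Rightarrow> (real \<Rightarrow> real \<Rightarrow> complex) \<Rightarrow> bool" where
  "frame_row p q s \<longleftrightarrow> (\<forall>x y.
     ((\<lambda>t. p t y) has_vector_derivative
        \<i> * (- E y * p x y - \<kappa> * Vi y * q x y + V y * s x y)) (at x) \<and>
     ((\<lambda>t. q t y) has_vector_derivative
        \<i> * (E y * q x y - cnj \<kappa> * Vi y * p x y + V y * s x y)) (at x) \<and>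
     ((\<lambda>t. s t y) has_vector_derivative \<i> * (p x y + q x y)) (at x) \<and>
     ((\<lambda>t. p x t) has_vector_derivative
        E y * p x y + \<kappa> * Vi y * q x y + V y * s x y) (at y) \<and>
     ((\<lambda>t. q x t) has_vector_derivative
        E y * q x y - cnj \<kappa> * Vi y * p x y - V y * s x y) (at y) \<and>
     ((\<lambda>t. s x t) has_vector_derivative q x y - p x y) (at y))"

lemma frame_rowD:
  assumes "frame_row p q s"
  shows "((\<lambda>t. p t y) has_vector_derivative
        \<i> * (- E y * p x y - \<kappa> * Vi y * q x y + V y * s x y)) (at x)"
    "((\<lambda>t. q t y) has_vector_derivative
        \<i> * (E y * q x y - cnj \<kappa> * Vi y * p x y + V y * s x y)) (at x)"
    "((\<lambda>t. s t y) has_vector_derivative \<i> * (p x y + q x y)) (at x)"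
    "((\<lambda>t. p x t) has_vector_derivative
        E y * p x y + \<kappa> * Vi y * q x y + V y * s x y) (at y)"
    "((\<lambda>t. q x t) has_vector_derivative
        E y * q x y - cnj \<kappa> * Vi y * p x y - V y * s x y) (at y)"
    "((\<lambda>t. s x t) has_vector_derivative q x y - p x y) (at y)"
  using assms unfolding frame_row_def by blast+

lemmas row_intros = has_vector_derivative_add has_vector_derivative_diff
  has_vector_derivative_mult has_vector_derivative_cnj has_vector_derivative_const
  V_deriv Vi_deriv E_deriv

lemma frame_row_combine:
  assumes "frame_row p q s" "frame_row p' q' s'"
  shows "frame_row (\<lambda>x y. a * p x y + b * p' x y) (\<lambda>x y. a * q x y + b * q' x y)
     (\<lambda>x y. a * s x y + b * s' x y)"
  unfolding frame_row_def
  apply (intro allI conjI)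
  by (rule has_vector_derivative_eq_rhs,
      (rule row_intros frame_rowD[OF assms(1)] frame_rowD[OF assms(2)])+,
      simp add: algebra_simps)+

text \<open>
  The standard Hermitian form on rows, written in the gauge of \<open>frame_row\<close>.
\<close>

definition pairing ::
  "complex \<Rightarrow> complex \<Rightarrow> complex \<Rightarrow> complex \<Rightarrow> complex \<Rightarrow> complex \<Rightarrow> real \<Rightarrow> complex" where
  "pairing p q s p' q' s' y = Vi y * (p * cnj p' + q * cnj q') + s * cnj s'"

text \<open>
  The coefficient matrices of the ungauged system are skew-Hermitian, so the standard form is preserved in both
  directions.
\<close>

lemma pairing_constant:
  assumes "frame_row p q s" "frame_row p' q' s'"
  shows "pairing (p x y) (q x y) (s x y) (p' x y) (q' x y) (s' x y) y =
    pairing (p 0 0) (q 0 0) (s 0 0) (p' 0 0) (q' 0 0) (s' 0 0) 0"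
  unfolding pairing_def
proof (rule constant_of_partial_derivatives)
  note D = frame_rowD[OF assms(1)] frame_rowD[OF assms(2)]
  fix x y
  show "((\<lambda>t. Vi y * (p t y * cnj (p' t y) + q t y * cnj (q' t y)) + s t y * cnj (s' t y))
     has_vector_derivative 0) (at x)"
    apply (rule has_vector_derivative_eq_rhs, (rule row_intros D)+)
    using V_Vi[of y] apply simp
    by algebra
  show "((\<lambda>t. Vi t * (p x t * cnj (p' x t) + q x t * cnj (q' x t)) + s x t * cnj (s' x t))
     has_vector_derivative 0) (at y)"
    apply (rule has_vector_derivative_eq_rhs, (rule row_intros D)+)
    using V_Vi[of y] apply simp
    by algebra
qed

lemma pairing_self_zero:
  assumes "pairing p q s p q s y = 0"
  shows "p = 0" "q = 0" "s = 0"
proof -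
  have "pairing p q s p q s y =
      of_real (exp (- u y) * ((cmod p)\<^sup>2 + (cmod q)\<^sup>2) + (cmod s)\<^sup>2)"
    by (simp add: pairing_def Vi_def complex_norm_square del: of_real_power)
  hence *: "exp (- u y) * ((cmod p)\<^sup>2 + (cmod q)\<^sup>2) + (cmod s)\<^sup>2 = 0"
    using assms by (metis of_real_eq_0_iff)
  have "0 \<le> exp (- u y) * ((cmod p)\<^sup>2 + (cmod q)\<^sup>2)" by simp
  with * have "(cmod s)\<^sup>2 = 0" "exp (- u y) * ((cmod p)\<^sup>2 + (cmod q)\<^sup>2) = 0"
    using zero_le_power2[of "cmod s"] by linarith+
  thus "p = 0" "q = 0" "s = 0" by (auto simp: sum_power2_eq_zero_iff)
qed

lemma frame_row_zero:
  assumes "frame_row p q s" "p 0 0 = 0" "q 0 0 = 0" "s 0 0 = 0"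
  shows "p x y = 0" "q x y = 0" "s x y = 0"
proof -
  have "pairing (p x y) (q x y) (s x y) (p x y) (q x y) (s x y) y = 0"
    using pairing_constant[OF assms(1,1)] assms(2-) by (simp add: pairing_def)
  thus "p x y = 0" "q x y = 0" "s x y = 0" using pairing_self_zero by blast+
qed

lemma frame_row_unique:
  assumes "frame_row p q s" "frame_row p' q' s'"
    "p 0 0 = p' 0 0" "q 0 0 = q' 0 0" "s 0 0 = s' 0 0"
  shows "p x y = p' x y" "q x y = q' x y" "s x y = s' x y"
  using frame_row_zero[OF frame_row_combine[OF assms(1,2), of 1 "-1"], of x y] assms(3-)
  by simp_all

text \<open>
  The eigenvalue equation for \<open>i d\<close> of the matrix that governs the \<open>x\<close>-derivative at height \<open>y\<close>, with
  \<open>i\<close> divided out.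
\<close>

definition eigen_triple :: "real \<Rightarrow> real \<Rightarrow> complex \<Rightarrow> complex \<Rightarrow> complex \<Rightarrow> bool" where
  "eigen_triple d y p q s \<longleftrightarrow>
     - E y * p - \<kappa> * Vi y * q + V y * s = d * p \<and>
     E y * q - cnj \<kappa> * Vi y * p + V y * s = d * q \<and>
     p + q = d * s"

text \<open>
  Applying the \<open>x\<close>-matrix minus \<open>d\<close> to a solution gives a solution. In the \<open>x\<close>-direction this
  holds because the matrix does not depend on \<open>x\<close>; in the \<open>y\<close>-direction it is the zero-curvature condition, which is the differential equation of \<open>u\<close>
  through \<open>E_deriv\<close>.
\<close>

lemma frame_row_commute:
  assumes "frame_row p q s"
  shows "frame_row
    (\<lambda>x y. - E y * p x y - \<kappa> * Vi y * q x y + V y * s x y - d * p x y)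
    (\<lambda>x y. E y * q x y - cnj \<kappa> * Vi y * p x y + V y * s x y - d * q x y)
    (\<lambda>x y. p x y + q x y - d * s x y)"
  unfolding frame_row_def
  apply (intro allI conjI)
  subgoal for x y
    apply (rule has_vector_derivative_eq_rhs, (rule row_intros frame_rowD[OF assms])+)
    apply simp by algebra
  subgoal for x y
    apply (rule has_vector_derivative_eq_rhs, (rule row_intros frame_rowD[OF assms])+)
    apply simp by algebra
  subgoal for x y
    apply (rule has_vector_derivative_eq_rhs, (rule row_intros frame_rowD[OF assms])+)
    apply simp by algebra
  subgoal for x y
    apply (rule has_vector_derivative_eq_rhs, (rule row_intros has_vector_derivative_minus frame_rowD[OF assms])+)
    by (simp add: algebra_simps power2_eq_square)
  subgoal for x y
    apply (rule has_vector_derivative_eq_rhs, (rule row_intros has_vector_derivative_minus frame_rowD[OF assms])+)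
    by (simp add: algebra_simps power2_eq_square)
  subgoal for x y
    apply (rule has_vector_derivative_eq_rhs, (rule row_intros has_vector_derivative_minus frame_rowD[OF assms])+)
    apply simp by algebra
  done

lemma eigen_triple_propagates:
  assumes "frame_row p q s" "eigen_triple d 0 (p 0 0) (q 0 0) (s 0 0)"
  shows "eigen_triple d y (p x y) (q x y) (s x y)"
proof -
  let ?a = "\<lambda>x y. - E y * p x y - \<kappa> * Vi y * q x y + V y * s x y - d * p x y"
  let ?b = "\<lambda>x y. E y * q x y - cnj \<kappa> * Vi y * p x y + V y * s x y - d * q x y"
  let ?c = "\<lambda>x y. p x y + q x y - d * s x y"
  have "?a 0 0 = 0" "?b 0 0 = 0" "?c 0 0 = 0"
    using assms(2) by (simp_all only: eigen_triple_def right_minus_eq)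
  hence "?a x y = 0" "?b x y = 0" "?c x y = 0"
    using frame_row_zero[where p = ?a and q = ?b and s = ?c and x = x and y = y]
      frame_row_commute[OF assms(1), of d] by blast+
  thus ?thesis by (simp only: eigen_triple_def right_minus_eq)
qed

lemma eigen_row_translation:
  assumes "frame_row p q s" "eigen_triple d 0 (p 0 0) (q 0 0) (s 0 0)"
  shows "s x y = cis (d * x) * s 0 y"
proof -
  have "((\<lambda>t. cis (- d * t) * s t y) has_vector_derivative 0) (at x)" for x
  proof -
    have "((\<lambda>z. exp (- \<i> * d * z)) has_field_derivative - \<i> * d * exp (- \<i> * d * of_real x)) (at (of_real x))"
      by (auto intro!: derivative_eq_intros)
    from has_vector_derivative_real_field[OF this]
    have *: "((\<lambda>t. cis (- d * t)) has_vector_derivative - \<i> * d * cis (- d * x)) (at x)"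
      by (simp add: cis_conv_exp mult.assoc)
    have "p x y + q x y = d * s x y"
      using eigen_triple_propagates[OF assms, of y x] unfolding eigen_triple_def by blast
    hence "cis (- d * x) * (\<i> * (p x y + q x y)) + - \<i> * d * cis (- d * x) * s x y = 0"
      by algebra
    thus ?thesis
      using has_vector_derivative_mult[OF * frame_rowD(3)[OF assms(1), of y x]] by metis
  qed
  then obtain c where c: "\<And>x. cis (- d * x) * s x y = c"
    using has_vector_derivative_zero_constant[of UNIV "\<lambda>t. cis (- d * t) * s t y"] by auto
  have "s x y = cis (d * x) * (cis (- d * x) * s x y)"
    by (simp add: mult.assoc[symmetric] cis_mult)
  also have "\<dots> = cis (d * x) * s 0 y"
    using c[of x] c[of 0] by simp
  finally show ?thesis .
qed

text \<open>
  The \<open>x\<close>-matrix is \<open>i\<close> times a matrix that is self-adjoint for the pairing.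
\<close>

lemma eigen_triples_orthogonal:
  assumes "eigen_triple d y p q s" "eigen_triple d' y p' q' s'" "d \<noteq> d'"
  shows "pairing p q s p' q' s' y = 0"
proof -
  have a: "- E y * p - \<kappa> * Vi y * q + V y * s = d * p"
     "E y * q - cnj \<kappa> * Vi y * p + V y * s = d * q"  "p + q = d * s"
    using assms(1) by (auto simp: eigen_triple_def)
  have "cnj (- E y * p' - \<kappa> * Vi y * q' + V y * s') = cnj (d' * p')"
     "cnj (E y * q' - cnj \<kappa> * Vi y * p' + V y * s') = cnj (d' * q')"
     "cnj (p' + q') = cnj (d' * s')"
    using assms(2) by (auto simp only: eigen_triple_def)
  hence b: "- E y * cnj p' - cnj \<kappa> * Vi y * cnj q' + V y * cnj s' = d' * cnj p'"
     "E y * cnj q' - \<kappa> * Vi y * cnj p' + V y * cnj s' = d' * cnj q'"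
     "cnj p' + cnj q' = d' * cnj s'" by simp_all
  have "(of_real d - of_real d') * pairing p q s p' q' s' y = 0"
    unfolding pairing_def using a b V_Vi[of y] by algebra
  thus ?thesis using assms(3) by simp
qed

lemma coeffs_shift:
  assumes per: "\<And>y. u (y + c) = u y"
  shows "E (y + c) = E y" "V (y + c) = V y" "Vi (y + c) = Vi y"
proof -
  have "((\<lambda>t. u (t + c)) has_real_derivative deriv u (y + c)) (at y)"
    using u_deriv[of "y + c"] by (simp only: DERIV_shift)
  hence "deriv u (y + c) = deriv u y"
    unfolding per using u_deriv[of y] DERIV_unique by blast
  thus "E (y + c) = E y" "V (y + c) = V y" "Vi (y + c) = Vi y"
    by (simp_all add: E_def V_def Vi_def per)
qed

lemma frame_row_shift:
  assumes per: "\<And>y. u (y + c) = u y" and r: "frame_row p q s"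
  shows "frame_row (\<lambda>x y. p x (y + c)) (\<lambda>x y. q x (y + c)) (\<lambda>x y. s x (y + c))"
proof -
  note co = coeffs_shift[OF per]
  have sh: "((\<lambda>t. t + c) has_real_derivative 1) (at y)" for y by (auto intro!: derivative_eq_intros)
  show ?thesis
    unfolding frame_row_def
  proof (intro allI conjI)
    fix x y
    note D = frame_rowD[OF r, where y = "y + c" and x = x, unfolded co]
    note Y = D(4-6)[THEN has_vector_derivative_compose_real[where g = "\<lambda>t. t + c", OF _ sh], unfolded scaleR_one]
    show "((\<lambda>t. p t (y + c)) has_vector_derivative
      \<i> * (- E y * p x (y + c) - \<kappa> * Vi y * q x (y + c) + V y * s x (y + c))) (at x)" by (rule D)
    show "((\<lambda>t. q t (y + c)) has_vector_derivative
      \<i> * (E y * q x (y + c) - cnj \<kappa> * Vi y * p x (y + c) + V y * s x (y + c))) (at x)" by (rule D)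
    show "((\<lambda>t. s t (y + c)) has_vector_derivative \<i> * (p x (y + c) + q x (y + c))) (at x)" by (rule D)
    show "((\<lambda>t. p x (t + c)) has_vector_derivative
      E y * p x (y + c) + \<kappa> * Vi y * q x (y + c) + V y * s x (y + c)) (at y)" by (rule Y)
    show "((\<lambda>t. q x (t + c)) has_vector_derivative
      E y * q x (y + c) - cnj \<kappa> * Vi y * p x (y + c) - V y * s x (y + c)) (at y)" by (rule Y)
    show "((\<lambda>t. s x (t + c)) has_vector_derivative q x (y + c) - p x (y + c)) (at y)" by (rule Y)
  qed
qed

text \<open>
  For real \<open>\<kappa>\<close> the \<open>y\<close>-system has real coefficients and the \<open>x\<close>-system imaginary ones, so conjugation has to be
  combined with the reflection \<open>x \<mapsto> - x\<close>.
\<close>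

lemma frame_row_conjugate:
  assumes real: "cnj \<kappa> = \<kappa>" and r: "frame_row p q s"
  shows "frame_row (\<lambda>x y. cnj (p (- x) y)) (\<lambda>x y. cnj (q (- x) y)) (\<lambda>x y. cnj (s (- x) y))"
proof -
  have mi: "((\<lambda>t. - t) has_real_derivative - 1) (at x)" for x :: real by (auto intro!: derivative_eq_intros)
  show ?thesis
    unfolding frame_row_def
  proof (intro allI conjI)
    fix x y
    note D = frame_rowD[OF r, where y = y and x = "- x", THEN has_vector_derivative_cnj]
    note X = D(1-3)[THEN has_vector_derivative_compose_real[where g = uminus, OF _ mi]]
    show "((\<lambda>t. cnj (p (- t) y)) has_vector_derivative
      \<i> * (- E y * cnj (p (- x) y) - \<kappa> * Vi y * cnj (q (- x) y) + V y * cnj (s (- x) y))) (at x)"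
      by (rule has_vector_derivative_eq_rhs[OF X(1)]) (simp add: real)
    show "((\<lambda>t. cnj (q (- t) y)) has_vector_derivative
      \<i> * (E y * cnj (q (- x) y) - cnj \<kappa> * Vi y * cnj (p (- x) y) + V y * cnj (s (- x) y))) (at x)"
      by (rule has_vector_derivative_eq_rhs[OF X(2)]) (simp add: real)
    show "((\<lambda>t. cnj (s (- t) y)) has_vector_derivative
      \<i> * (cnj (p (- x) y) + cnj (q (- x) y))) (at x)"
      by (rule has_vector_derivative_eq_rhs[OF X(3)]) simp
    show "((\<lambda>t. cnj (p (- x) t)) has_vector_derivative
      E y * cnj (p (- x) y) + \<kappa> * Vi y * cnj (q (- x) y) + V y * cnj (s (- x) y)) (at y)"
      by (rule has_vector_derivative_eq_rhs[OF D(4)]) (simp add: real)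
    show "((\<lambda>t. cnj (q (- x) t)) has_vector_derivative
      E y * cnj (q (- x) y) - cnj \<kappa> * Vi y * cnj (p (- x) y) - V y * cnj (s (- x) y)) (at y)"
      by (rule has_vector_derivative_eq_rhs[OF D(5)]) (simp add: real)
    show "((\<lambda>t. cnj (s (- x) t)) has_vector_derivative
      cnj (q (- x) y) - cnj (p (- x) y)) (at y)"
      by (rule has_vector_derivative_eq_rhs[OF D(6)]) simp
  qed
qed

lemma frame_row_real:
  assumes "cnj \<kappa> = \<kappa>" "frame_row p q s" "cnj (p 0 0) = p 0 0" "cnj (q 0 0) = q 0 0" "cnj (s 0 0) = s 0 0"
  shows "cnj (p 0 y) = p 0 y" "cnj (q 0 y) = q 0 y" "cnj (s 0 y) = s 0 y"
  using frame_row_unique[OF frame_row_conjugate[OF assms(1,2)] assms(2), where x = 0 and y = y] assms(3-)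
  by simp_all

end

section \<open>The slope equation and the integral \<open>\<beta>\<^sub>2\<close>\<close>

context tzitzeica_surface
begin

definition beta2_integrand :: "real \<Rightarrow> complex" where
  "beta2_integrand y = 2 * V y / (cnj \<kappa> - \<kappa> - 2 * V y * E y)"

lemma beta2_eq: "beta2 \<psi> u y l = (LBINT s=0..y. beta2_integrand s)"
  unfolding beta2_def beta2_integrand_def cnj_\<kappa> by (simp add: \<kappa>_def V_def E_def)

text \<open>
  The integrand is real-valued here, so the integral is real: either it converges to a real number, or
  the function is not integrable and the integral has the default value \<open>0\<close>.
\<close>

lemma Im_beta2_real:
  assumes "cnj \<kappa> = \<kappa>"
  shows "Im (beta2 \<psi> u y l) = 0"
proof -
  have "beta2_integrand = (\<lambda>s. of_real (2 * exp (u s) / (- 2 * exp (u s) * (deriv u s / 2))))"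
    using assms by (auto simp: beta2_integrand_def V_def E_def)
  thus ?thesis unfolding beta2_eq by (simp only: interval_lebesgue_integral_of_real Im_complex_of_real)
qed

lemma denominator_nonzero:
  assumes "cnj \<kappa> \<noteq> \<kappa>"
  shows "cnj \<kappa> - \<kappa> - 2 * V y * E y \<noteq> 0"
proof
  assume "cnj \<kappa> - \<kappa> - 2 * V y * E y = 0"
  hence "Im (cnj \<kappa> - \<kappa> - 2 * V y * E y) = 0" by simp
  hence "Im \<kappa> = 0" by (simp add: V_def E_def)
  thus False using assms by (simp add: complex_eq_iff)
qed

lemma coeffs_continuous: "continuous_on A V" "continuous_on A Vi" "continuous_on A E"
  using V_deriv Vi_deriv E_deriv has_vector_derivative_continuous
  by (meson continuous_at_imp_continuous_on)+

lemma beta2_integrand_continuous: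
  assumes "cnj \<kappa> \<noteq> \<kappa>"
  shows "continuous_on A beta2_integrand"
  unfolding beta2_integrand_def[abs_def]
  by (intro continuous_intros coeffs_continuous ballI denominator_nonzero assms)

lemma eigen_triple_slope:
  assumes "eigen_triple d y p q s"
  shows "(q - p) * (\<kappa> - cnj \<kappa> - 2 * V y * E y) = 2 * V y * (2 * V y - d\<^sup>2 - d * Re \<kappa> * Vi y) * s"
proof -
  have re: "2 * of_real (Re \<kappa>) = \<kappa> + cnj \<kappa>" by (simp add: complex_add_cnj)
  have a: "- E y * p - \<kappa> * Vi y * q + V y * s = d * p"
     "E y * q - cnj \<kappa> * Vi y * p + V y * s = d * q"  "p + q = d * s"
    using assms by (auto simp: eigen_triple_def)
  have "(q - p) * (\<kappa> - cnj \<kappa> - 2 * V y * E y) = V y * (4 * V y - 2 * (of_real d)\<^sup>2 - d * (\<kappa> + cnj \<kappa>) * Vi y) * s"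
    using a V_Vi[of y] by algebra
  thus ?thesis unfolding re[symmetric] by (simp add: algebra_simps)
qed

text \<open>
  Since \<open>q - p\<close> is the \<open>y\<close>-derivative of \<open>s\<close>, this is a linear scalar equation for \<open>s\<close> alone. The eigenvalue
  enters only through a quadratic polynomial, and the other factor is the conjugate integrand of \<open>beta2\<close>.
\<close>

lemma eigen_triple_log_derivative:
  assumes "eigen_triple d y p q s" "cnj \<kappa> \<noteq> \<kappa>"
  shows "q - p = cnj (beta2_integrand y) * (2 * V y - d\<^sup>2 - d * Re \<kappa> * Vi y) * s"
proof -
  have "cnj (cnj \<kappa> - \<kappa> - 2 * V y * E y) \<noteq> 0"
    using denominator_nonzero[OF assms(2)] by (simp only: complex_cnj_zero_iff not_False_eq_True)
  hence "\<kappa> - cnj \<kappa> - 2 * V y * E y \<noteq> 0" by simp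
  thus ?thesis using eigen_triple_slope[OF assms(1)]
    unfolding beta2_integrand_def by (simp add: field_simps)
qed

end

section \<open>The spectrum of the potential\<close>

context tzitzeica_surface
begin

lemma E_0 [simp]: "E 0 = 0"
  using profile by (simp add: E_def tzitzeica_profile_def)

lemma coeff_beta_eq: "coeff_beta \<psi> u = 2 * exp (u 0) + (cmod \<psi>)\<^sup>2 * (exp (- u 0))\<^sup>2"
proof -
  have r: "(exp (u 0 / 2))\<^sup>2 = exp (u 0)" by (simp add: exp_double[symmetric])
  have a: "(cmod (coeff_a u))\<^sup>2 = exp (u 0)"
    by (simp add: coeff_a_def norm_mult r)
  moreover have "cmod (coeff_b \<psi> u) = cmod \<psi> * exp (- u 0)"
    unfolding coeff_b_def norm_divide norm_mult norm_power a by (simp add: exp_minus field_simps)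
  ultimately show ?thesis by (simp add: coeff_beta_def power_mult_distrib)
qed

lemma coeff_beta_complex: "of_real (coeff_beta \<psi> u) = 2 * V 0 + \<kappa> * cnj \<kappa> * (Vi 0)\<^sup>2"
  by (simp add: coeff_beta_eq V_def Vi_def \<kappa>_cnj)

lemma first_integral: "E y * E y + \<kappa> * cnj \<kappa> * (Vi y * Vi y) + 2 * V y = of_real (coeff_beta \<psi> u)"
proof -
  have "((\<lambda>y. E y * E y + \<kappa> * cnj \<kappa> * (Vi y * Vi y) + 2 * V y) has_vector_derivative 0) (at y)" for y
    apply (rule has_vector_derivative_eq_rhs, (rule row_intros)+)
    apply simp
    by algebra
  then obtain c where "\<And>y. E y * E y + \<kappa> * cnj \<kappa> * (Vi y * Vi y) + 2 * V y = c"
    using has_vector_derivative_zero_constant[of UNIV "\<lambda>y. E y * E y + \<kappa> * cnj \<kappa> * (Vi y * Vi y) + 2 * V y"]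
    by auto
  from this[of y] this[of 0] show ?thesis
    by (simp add: coeff_beta_complex power2_eq_square add.commute)
qed

text \<open>
  These would be the relations for a double eigenvalue \<open>\<delta>\<close>. The first integral then reads
  \<open>(v u' / 2)\<^sup>2 + (v - \<delta>\<^sup>2)\<^sup>2 (2 v + \<delta>\<^sup>2) + (\<bar>\<kappa>\<bar>\<^sup>2 - (Re \<kappa>)\<^sup>2) = 0\<close> with \<open>v = exp u > 0\<close>, a sum of non-negative terms, and
  forces \<open>v\<close> to be constant.
\<close>

lemma no_double_root:
  assumes "coeff_beta \<psi> u = 3 * \<delta>\<^sup>2" "Re \<kappa> = \<delta> ^ 3"
  shows False
proof -
  have "u y = ln (\<delta>\<^sup>2)" for y
  proof -
    define v e where "v = exp (u y)" and "e = deriv u y / 2"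
    have v: "v > 0" by (simp add: v_def)
    have "of_real (e * e + (cmod \<psi>)\<^sup>2 * (inverse v * inverse v) + 2 * v) = complex_of_real (3 * \<delta>\<^sup>2)"
      using first_integral[of y] unfolding assms(1) \<kappa>_cnj
      by (simp add: E_def V_def Vi_def v_def e_def exp_minus)
    hence "e * e + (cmod \<psi>)\<^sup>2 * (inverse v * inverse v) + 2 * v = 3 * \<delta>\<^sup>2"
      by (simp only: of_real_eq_iff)
    moreover have "v * inverse v = 1" using v by simp
    ultimately have *: "(v * e)\<^sup>2 + (cmod \<psi>)\<^sup>2 + 2 * v ^ 3 = 3 * \<delta>\<^sup>2 * v\<^sup>2" by algebra
    have "(\<delta> ^ 3)\<^sup>2 \<le> (cmod \<psi>)\<^sup>2"
      using complex_Re_le_cmod[of \<kappa>] abs_Re_le_cmod[of \<kappa>] unfolding assms(2) cmod_\<kappa>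
      by (metis abs_ge_zero power2_abs power_mono)
    moreover have "(v - \<delta>\<^sup>2)\<^sup>2 * (2 * v + \<delta>\<^sup>2) = 2 * v ^ 3 - 3 * \<delta>\<^sup>2 * v\<^sup>2 + (\<delta> ^ 3)\<^sup>2"
      by (simp add: power2_eq_square power3_eq_cube algebra_simps)
    moreover have "(v * e)\<^sup>2 \<ge> 0" by simp
    ultimately have "(v - \<delta>\<^sup>2)\<^sup>2 * (2 * v + \<delta>\<^sup>2) \<le> 0" using * by linarith
    moreover have "2 * v + \<delta>\<^sup>2 > 0" using v by (simp add: add_pos_nonneg)
    ultimately have "(v - \<delta>\<^sup>2)\<^sup>2 \<le> 0" by (simp add: mult_le_0_iff)
    hence "v = \<delta>\<^sup>2" by simp
    thus ?thesis unfolding v_def by (metis ln_exp)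
  qed
  thus False using profile by (auto simp: tzitzeica_profile_def constant_on_def)
qed

lemma det_potential:
  fixes \<mu> :: complex
  shows "det (mat \<mu> - potential \<psi> u l) =
    \<mu> ^ 3 + of_real (coeff_beta \<psi> u) * \<mu> - \<i> * (\<kappa> + cnj \<kappa>)"
proof -
  define r where "r = complex_of_real (exp (u 0 / 2))"
  have r: "r * r = V 0" "cnj r = r" "r \<noteq> 0"
    by (simp_all add: r_def V_def exp_double[symmetric] of_real_mult[symmetric] exp_add[symmetric] del: of_real_mult)
  have a: "coeff_a u = \<i> * r" by (simp add: coeff_a_def r_def)
  have "coeff_b \<psi> u = \<i> * \<psi> / ((\<i> * r) * (\<i> * r))" by (simp add: coeff_b_def a power2_eq_square)
  also have "(\<i> * r) * (\<i> * r) = - V 0" unfolding r(1)[symmetric] by (simp add: algebra_simps)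
  also have "\<i> * \<psi> / - V 0 = - \<i> * \<psi> * Vi 0"
    by (simp add: V_def Vi_def exp_minus divide_inverse)
  finally have b: "coeff_b \<psi> u = - \<i> * \<kappa> * l ^ 3 * Vi 0" by (simp add: \<kappa>_def)
  have cb: "cnj (coeff_b \<psi> u) = \<i> * cnj \<kappa> * Vi 0 / l ^ 3" unfolding b by (simp add: cnj_l power_one_over)
  have ca: "cnj (coeff_a u) = - \<i> * r" unfolding a by (simp add: r)
  have m: "mat \<mu> - potential \<psi> u l = vector [
     vector [\<mu>, \<i> * cnj \<kappa> * Vi 0 / l\<^sup>2, - \<i> * r / l],
     vector [\<i> * \<kappa> * l\<^sup>2 * Vi 0, \<mu>, - l * \<i> * r],
     vector [- l * \<i> * r, - \<i> * r / l, \<mu>]]"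
    unfolding potential_def Let_def cb ca unfolding a b
    by (simp add: vec_eq_iff forall_3 mat_def field_simps power2_eq_square power3_eq_cube)
  have ii: "\<i> * \<i> = -1" by simp
  have "det (mat \<mu> - potential \<psi> u l) = \<mu> ^ 3 + (2 * (r * r) + \<kappa> * cnj \<kappa> * (Vi 0)\<^sup>2) * \<mu>
      - \<i> * (\<kappa> + cnj \<kappa>) * (r * r * Vi 0)"
    unfolding m det_3 vector_3 by (simp add: field_simps power2_eq_square power3_eq_cube)
  thus ?thesis unfolding coeff_beta_complex r V_Vi by simp
qed

lemma spectrum_relations:
  assumes "imaginary_spectrum (potential \<psi> u l) d1 d2 d3"
  shows "d1 + d2 + d3 = 0" "d1 * d2 + d1 * d3 + d2 * d3 = - coeff_beta \<psi> u" "d1 * d2 * d3 = - 2 * Re \<kappa>"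
proof -
  have *: "\<mu> ^ 3 + of_real (coeff_beta \<psi> u) * \<mu> - \<i> * of_real (2 * Re \<kappa>) =
     (\<mu> - \<i> * of_real d1) * (\<mu> - \<i> * of_real d2) * (\<mu> - \<i> * of_real d3)" for \<mu>
    using assms det_potential[of \<mu>] unfolding imaginary_spectrum_def complex_add_cnj by simp
  show 3: "d1 * d2 * d3 = - 2 * Re \<kappa>" using *[of 0] by (simp add: complex_eq_iff)
  show "d1 + d2 + d3 = 0" "d1 * d2 + d1 * d3 + d2 * d3 = - coeff_beta \<psi> u"
    using *[of 1] 3 by (simp_all add: complex_eq_iff algebra_simps)
qed

lemma spectrum_distinct:
  assumes "d1 + d2 + d3 = 0" "d1 * d2 + d1 * d3 + d2 * d3 = - coeff_beta \<psi> u" "d1 * d2 * d3 = - 2 * Re \<kappa>"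
  shows "d1 \<noteq> d2"
proof
  assume "d1 = d2"
  moreover have d3: "d3 = - d1 - d2" using assms(1) by linarith
  ultimately have "coeff_beta \<psi> u = 3 * d1\<^sup>2" "Re \<kappa> = d1 ^ 3"
    using assms(2,3) by (simp_all add: power2_eq_square power3_eq_cube algebra_simps)
  thus False by (rule no_double_root)
qed

text \<open>
  The eigenvector is written down explicitly at \<open>y = 0\<close>, where \<open>E\<close> vanishes. For non-real \<open>\<kappa>\<close> one may take
  \<open>s = 1\<close>, because \<open>eigen_triple_slope\<close> then determines \<open>q - p\<close>. For real \<open>\<kappa>\<close> the characteristic polynomial factors
  according to the antisymmetric and symmetric vectors in \<open>(p, q)\<close>, and the eigenvector is real.
\<close>

lemma eigen_triple_exists:
  fixes d :: real
  assumes root: "d ^ 3 - coeff_beta \<psi> u * d + 2 * Re \<kappa> = 0"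
  obtains p q s where "eigen_triple d 0 p q s" "\<not> (p = 0 \<and> q = 0 \<and> s = 0)"
    "cnj \<kappa> = \<kappa> \<longrightarrow> cnj p = p \<and> cnj q = q \<and> cnj s = s"
proof -
  have "complex_of_real (d ^ 3 - coeff_beta \<psi> u * d + 2 * Re \<kappa>) = 0" unfolding root by simp
  hence cr: "of_real d ^ 3 - (2 * V 0 + \<kappa> * cnj \<kappa> * (Vi 0)\<^sup>2) * of_real d + (\<kappa> + cnj \<kappa>) = 0"
    by (simp add: coeff_beta_complex complex_add_cnj)
  have VV: "V 0 * Vi 0 = 1" by (rule V_Vi)
  show thesis
  proof (cases "cnj \<kappa> = \<kappa>")
    case False
    define w where "w = 1 / (\<kappa> - cnj \<kappa>)"
    have w: "w * (\<kappa> - cnj \<kappa>) = 1" using False by (simp add: w_def)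
    \<comment> \<open>The value of \<open>q - p\<close> dictated by \<open>eigen_triple_slope\<close> for \<open>s = 1\<close>.\<close>
    define \<Delta> where "\<Delta> = V 0 * (4 * V 0 - 2 * (of_real d)\<^sup>2 - d * (\<kappa> + cnj \<kappa>) * Vi 0) * w"
    define p where "p = (d - \<Delta>) / 2"
    define q where "q = (d + \<Delta>) / 2"
    have pq: "2 * p = d - \<Delta>" "2 * q = d + \<Delta>" by (simp_all add: p_def q_def)
    have D: "\<Delta> * (\<kappa> - cnj \<kappa>) = V 0 * (4 * V 0 - 2 * (of_real d)\<^sup>2 - d * (\<kappa> + cnj \<kappa>) * Vi 0)"
      unfolding \<Delta>_def using w by algebra
    have "(\<kappa> - cnj \<kappa>) * (2 * (- \<kappa> * Vi 0 * q + V 0) - 2 * (d * p)) = 0"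
      using pq D VV cr by algebra
    moreover have "(\<kappa> - cnj \<kappa>) * (2 * (- cnj \<kappa> * Vi 0 * p + V 0) - 2 * (d * q)) = 0"
      using pq D VV cr by algebra
    moreover have "\<kappa> - cnj \<kappa> \<noteq> 0" using False by simp
    ultimately have "- \<kappa> * Vi 0 * q + V 0 = d * p" "- cnj \<kappa> * Vi 0 * p + V 0 = d * q"
      by (metis mult_eq_0_iff right_minus_eq zero_neq_numeral mult_cancel_left)+
    moreover have "p + q = d * 1" by (simp add: p_def q_def field_simps)
    ultimately have "eigen_triple d 0 p q 1" unfolding eigen_triple_def by simp
    thus thesis using that[of p q 1] False by simp
  next
    case True
    show thesis
    proof (cases "d = \<kappa> * Vi 0")
      case d: True
      have "eigen_triple d 0 1 (- 1) 0" unfolding eigen_triple_def using d True by simp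
      thus thesis using that[of 1 "- 1" 0] by simp
    next
      case False
      have "(of_real d - \<kappa> * Vi 0) * ((of_real d)\<^sup>2 + d * \<kappa> * Vi 0 - 2 * V 0) = 0"
        using cr VV unfolding True by algebra
      hence "(of_real d)\<^sup>2 + d * \<kappa> * Vi 0 - 2 * V 0 = 0" using False by simp
      hence "V 0 = (of_real d)\<^sup>2 / 2 + d * \<kappa> * Vi 0 / 2" by (simp add: field_simps)
      hence "- \<kappa> * Vi 0 * (d / 2) + V 0 = d * (of_real d / 2)" by (simp add: power2_eq_square)
      hence "eigen_triple d 0 (d / 2) (d / 2) 1"
        unfolding eigen_triple_def True by simp
      thus thesis using that[of "d / 2" "d / 2" 1] by simp
    qed
  qed
qed

end

section \<open>From the extended frame to gauged rows\<close>

context tzitzeica_surface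
begin

lemma wirtinger_u:
  "d_z (\<lambda>w. of_real (u (Im w))) z = - \<i> * E (Im z)"
  "d_zbar (\<lambda>w. of_real (u (Im w))) z = \<i> * E (Im z)"
proof -
  have "((\<lambda>w. u (Im w)) has_derivative (\<lambda>w. deriv u (Im z) * Im w)) (at z)"
    using has_derivative_compose[OF has_derivative_Im[OF has_derivative_ident] u_deriv[unfolded has_field_derivative_def]] by simp
  hence "((\<lambda>w. complex_of_real (u (Im w))) has_derivative (\<lambda>w. of_real (deriv u (Im z) * Im w))) (at z)"
    by (rule has_derivative_of_real)
  hence f: "frechet_derivative (\<lambda>w. complex_of_real (u (Im w))) (at z) = (\<lambda>w. of_real (deriv u (Im z) * Im w))"
    using frechet_derivative_at by metis
  show "d_z (\<lambda>w. of_real (u (Im w))) z = - \<i> * E (Im z)"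
       "d_zbar (\<lambda>w. of_real (u (Im w))) z = \<i> * E (Im z)"
    by (simp_all add: d_z_def d_zbar_def f E_def)
qed

definition sqrtV :: "real \<Rightarrow> complex" where "sqrtV y = of_real (exp (u y / 2))"

lemma sqrtV_square: "sqrtV y * sqrtV y = V y"
  by (simp add: sqrtV_def V_def of_real_mult[symmetric] exp_add[symmetric] del: of_real_mult)

lemma sqrtV_deriv: "(sqrtV has_vector_derivative E y * sqrtV y) (at y)"
proof -
  have "((\<lambda>y. exp (u y / 2)) has_real_derivative exp (u y / 2) * (deriv u y / 2)) (at y)"
    by (auto intro!: derivative_eq_intros u_deriv)
  from has_vector_derivative_of_real[where ?'a = complex, OF this]
  show ?thesis unfolding sqrtV_def[abs_def] E_def by (simp add: mult.commute)
qed

lemma sqrtV_nonzero [simp]: "sqrtV y \<noteq> 0" by (simp add: sqrtV_def)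

text \<open>
  Multiplied by the frame from the left, the Lax equations express the derivatives of each row linearly in the row
  itself. The gauge factor \<open>exp(u/2)\<close> contributes the diagonal terms in the \<open>y\<close>-direction.
\<close>

lemma frame_rows:
  assumes F: "extended_frame \<psi> u l F"
  shows "frame_row (\<lambda>x y. sqrtV y * F (Complex x y) $ b $ 1 / l) (\<lambda>x y. l * sqrtV y * F (Complex x y) $ b $ 2)
    (\<lambda>x y. F (Complex x y) $ b $ 3)"
proof -
  have "F z ** matrix_inv (F z) = mat 1" for z
  proof -
    have "map_matrix cnj (transpose (F z)) ** F z = mat 1"
      using F by (auto simp: extended_frame_def SU3_def)
    hence "invertible (F z)" using invertible_left_inverse by blast
    thus ?thesis unfolding invertible_def matrix_inv_def by (rule someI2_ex) blast
  qed
  hence c: "X = F z ** Y" if "matrix_inv (F z) ** X = Y" for X Y z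
    using that by (metis matrix_mul_assoc matrix_mul_lid)
  have dz: "d_z (\<lambda>w. F w $ b $ j) z = (F z ** lax_U \<psi> u l z) $ b $ j"
   and dzb: "d_zbar (\<lambda>w. F w $ b $ j) z = (F z ** lax_V \<psi> u l z) $ b $ j" for j z
    using c[of z "\<chi> i j. d_z (\<lambda>w. F w $ i $ j) z" "lax_U \<psi> u l z"]
      c[of z "\<chi> i j. d_zbar (\<lambda>w. F w $ i $ j) z" "lax_V \<psi> u l z"] F
    unfolding extended_frame_def by (metis (no_types, lifting) vec_lambda_beta)+
  have diff: "(\<lambda>w. F w $ b $ j) differentiable (at z)" for j z
  proof -
    have "F differentiable (at z)" using F by (simp add: extended_frame_def)
    then obtain F' where "(F has_derivative F') (at z)" by (auto simp: differentiable_def)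
    hence "((\<lambda>w. F w $ b $ j) has_derivative (\<lambda>h. F' h $ b $ j)) (at z)"
      by (intro bounded_linear.has_derivative[OF bounded_linear_vec_nth])
    thus ?thesis by (auto simp: differentiable_def)
  qed
  have \<psi>: "\<psi> = l ^ 3 * \<kappa>" "cnj \<psi> = cnj \<kappa> / l ^ 3"
    unfolding cnj_\<kappa> by (simp_all add: \<kappa>_def)
  have e: "complex_of_real (exp (- u y)) = Vi y" "complex_of_real (exp (u y / 2)) = sqrtV y" for y
    by (simp_all add: Vi_def sqrtV_def)
  define f where "f j x y = F (Complex x y) $ b $ j" for j x y
  have fz: "d_z (\<lambda>w. F w $ b $ 1) (Complex x y) = f 1 x y * (- \<i> * E y / 2) + f 2 x y * (- \<i> * \<kappa> * Vi y * l\<^sup>2)"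
     "d_z (\<lambda>w. F w $ b $ 2) (Complex x y) = f 2 x y * (\<i> * E y / 2) + f 3 x y * (\<i> * sqrtV y / l)"
     "d_z (\<lambda>w. F w $ b $ 3) (Complex x y) = f 1 x y * (\<i> * sqrtV y / l)" for x y
    unfolding dz lax_U_def Let_def matrix_matrix_mult_def wirtinger_u sum_3 e f_def
    by (simp_all add: \<kappa>_def power2_eq_square power3_eq_cube)
  have fzb: "d_zbar (\<lambda>w. F w $ b $ 1) (Complex x y) = f 1 x y * (- \<i> * E y / 2) + f 3 x y * (\<i> * l * sqrtV y)"
     "d_zbar (\<lambda>w. F w $ b $ 2) (Complex x y) = f 1 x y * (- \<i> * cnj \<kappa> * Vi y / l\<^sup>2) + f 2 x y * (\<i> * E y / 2)"
     "d_zbar (\<lambda>w. F w $ b $ 3) (Complex x y) = f 2 x y * (\<i> * l * sqrtV y)" for x y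
    unfolding dzb lax_V_def Let_def matrix_matrix_mult_def wirtinger_u sum_3 e f_def
    by (simp_all add: cnj_\<kappa> power2_eq_square power3_eq_cube)
  have X: "((\<lambda>t. f 1 t y) has_vector_derivative f 1 x y * (- \<i> * E y) + f 2 x y * (- \<i> * \<kappa> * Vi y * l\<^sup>2) + f 3 x y * (\<i> * l * sqrtV y)) (at x)"
    "((\<lambda>t. f 2 t y) has_vector_derivative f 1 x y * (- \<i> * cnj \<kappa> * Vi y / l\<^sup>2) + f 2 x y * (\<i> * E y) + f 3 x y * (\<i> * sqrtV y / l)) (at x)"
    "((\<lambda>t. f 3 t y) has_vector_derivative f 1 x y * (\<i> * sqrtV y / l) + f 2 x y * (\<i> * l * sqrtV y)) (at x)" for x y
    using line_derivatives(1)[OF diff[of 1 "Complex x y"]] line_derivatives(1)[OF diff[of 2 "Complex x y"]] line_derivatives(1)[OF diff[of 3 "Complex x y"]]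
    unfolding fz fzb f_def[symmetric] by (simp_all add: algebra_simps)
  have Y: "((\<lambda>t. f 1 x t) has_vector_derivative f 2 x y * (\<kappa> * Vi y * l\<^sup>2) + f 3 x y * (l * sqrtV y)) (at y)"
    "((\<lambda>t. f 2 x t) has_vector_derivative - f 3 x y * (sqrtV y / l) - f 1 x y * (cnj \<kappa> * Vi y / l\<^sup>2)) (at y)"
    "((\<lambda>t. f 3 x t) has_vector_derivative f 2 x y * (l * sqrtV y) - f 1 x y * (sqrtV y / l)) (at y)" for x y
    using line_derivatives(2)[OF diff[of 1 "Complex x y"]] line_derivatives(2)[OF diff[of 2 "Complex x y"]] line_derivatives(2)[OF diff[of 3 "Complex x y"]]
    unfolding fz fzb f_def[symmetric] by (simp_all add: algebra_simps)
  define li where "li = 1 / l"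
  have "frame_row (\<lambda>x y. sqrtV y * f 1 x y * li) (\<lambda>x y. l * sqrtV y * f 2 x y) (\<lambda>x y. f 3 x y)"
    unfolding frame_row_def
  proof (intro allI conjI)
    fix x y
    note I = has_vector_derivative_mult has_vector_derivative_const sqrtV_deriv X[of y x] Y[of x y]
    note norm_simps = sqrtV_square[symmetric] li_def field_simps power2_eq_square
    show "((\<lambda>t. sqrtV y * f 1 t y * li) has_vector_derivative
        \<i> * (- E y * (sqrtV y * f 1 x y * li) - \<kappa> * Vi y * (l * sqrtV y * f 2 x y) + V y * f 3 x y)) (at x)"
      by (rule has_vector_derivative_eq_rhs, (rule I)+) (simp add: norm_simps)
    show "((\<lambda>t. l * sqrtV y * f 2 t y) has_vector_derivative
        \<i> * (E y * (l * sqrtV y * f 2 x y) - cnj \<kappa> * Vi y * (sqrtV y * f 1 x y * li) + V y * f 3 x y)) (at x)"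
      by (rule has_vector_derivative_eq_rhs, (rule I)+) (simp add: norm_simps)
    show "((\<lambda>t. f 3 t y) has_vector_derivative \<i> * (sqrtV y * f 1 x y * li + l * sqrtV y * f 2 x y)) (at x)"
      by (rule has_vector_derivative_eq_rhs, (rule I)+) (simp add: norm_simps)
    show "((\<lambda>t. sqrtV t * f 1 x t * li) has_vector_derivative
        E y * (sqrtV y * f 1 x y * li) + \<kappa> * Vi y * (l * sqrtV y * f 2 x y) + V y * f 3 x y) (at y)"
      by (rule has_vector_derivative_eq_rhs, (rule I)+) (simp add: norm_simps)
    show "((\<lambda>t. l * sqrtV t * f 2 x t) has_vector_derivative
        E y * (l * sqrtV y * f 2 x y) - cnj \<kappa> * Vi y * (sqrtV y * f 1 x y * li) - V y * f 3 x y) (at y)"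
      by (rule has_vector_derivative_eq_rhs, (rule I)+) (simp add: norm_simps)
    show "((\<lambda>t. f 3 x t) has_vector_derivative l * sqrtV y * f 2 x y - sqrtV y * f 1 x y * li) (at y)"
      by (rule has_vector_derivative_eq_rhs, (rule I)+) (simp add: norm_simps)
  qed
  thus ?thesis by (simp add: f_def li_def)
qed

text \<open>
  Solutions with arbitrary initial value are combinations of the three rows of the frame, so their third entry is
  a linear form in the vector that represents the immersion.
\<close>

lemma frame_row_exists:
  assumes F: "extended_frame \<psi> u l F"
  obtains p q s and \<rho> :: "complex^3" where "frame_row p q s" "p 0 0 = p0" "q 0 0 = q0" "s 0 0 = s0"
    "\<forall>x y. s x y = (\<Sum>b\<in>UNIV. \<rho>$b * F (Complex x y)$b$3)"
proof -
  define c1 c2 where "c1 = p0 * l / sqrtV 0" and "c2 = q0 / (l * sqrtV 0)"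
  have F0: "F (Complex 0 0) = mat 1" using F by (simp add: extended_frame_def Complex_eq)
  note r = frame_row_combine[OF frame_row_combine[OF frame_rows[OF F, of 1] frame_rows[OF F, of 2], of c1 c2]
      frame_rows[OF F, of 3], of 1 s0]
  show thesis
    by (rule that[OF r, of "vector [c1, c2, s0]"])
       (simp_all add: F0 mat_def c1_def c2_def sum_3)
qed

end

section \<open>Homogeneous coordinates from eigenrows\<close>

text \<open>
  Three eigenrows for distinct eigenvalues; their third entries are the homogeneous coordinates of the immersion.
\<close>

locale eigenframe = tzitzeica_surface +
  fixes d :: "3 \<Rightarrow> real" and P Q S :: "3 \<Rightarrow> real \<Rightarrow> real \<Rightarrow> complex"
  assumes d_inj: "inj d"
    and rows: "\<And>i. frame_row (P i) (Q i) (S i)"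
    and eigen_at_0: "\<And>i. eigen_triple (d i) 0 (P i 0 0) (Q i 0 0) (S i 0 0)"
    and nontrivial: "\<And>i. \<not> (P i 0 0 = 0 \<and> Q i 0 0 = 0 \<and> S i 0 0 = 0)"
begin

definition normsq :: "3 \<Rightarrow> complex" where
  "normsq i = pairing (P i 0 0) (Q i 0 0) (S i 0 0) (P i 0 0) (Q i 0 0) (S i 0 0) 0"

lemma normsq_nonzero [simp]: "normsq i \<noteq> 0"
  using pairing_self_zero nontrivial unfolding normsq_def by metis

lemma eigen: "eigen_triple (d i) y (P i x y) (Q i x y) (S i x y)"
  using eigen_triple_propagates rows eigen_at_0 by blast

lemma eigen_sum: "P i x y + Q i x y = d i * S i x y"
  using eigen unfolding eigen_triple_def by blast

lemma S_translation: "S i x y = cis (d i * x) * S i 0 y"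
  using eigen_row_translation rows eigen_at_0 by blast

lemma pairing_rows:
  "pairing (P i x y) (Q i x y) (S i x y) (P j x y) (Q j x y) (S j x y) y = (if i = j then normsq i else 0)"
proof (cases "i = j")
  case True
  thus ?thesis using pairing_constant[OF rows[of i] rows[of i], where x = x and y = y] by (simp add: normsq_def)
next
  case False
  hence "d i \<noteq> d j" using d_inj by (auto dest: injD)
  with False show ?thesis using eigen_triples_orthogonal[OF eigen eigen] by simp
qed

text \<open>
  The eigenrows are orthogonal at each point, so the columns of the matrix that they form are orthogonal as well.
\<close>

lemma completeness:
  "Vi y * (\<Sum>i\<in>UNIV. cnj (P i x y) * P i x y / normsq i) = 1"
  "Vi y * (\<Sum>i\<in>UNIV. cnj (P i x y) * Q i x y / normsq i) = 0"
  "Vi y * (\<Sum>i\<in>UNIV. cnj (P i x y) * S i x y / normsq i) = 0"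
  "Vi y * (\<Sum>i\<in>UNIV. cnj (Q i x y) * P i x y / normsq i) = 0"
  "Vi y * (\<Sum>i\<in>UNIV. cnj (Q i x y) * Q i x y / normsq i) = 1"
  "Vi y * (\<Sum>i\<in>UNIV. cnj (Q i x y) * S i x y / normsq i) = 0"
  "(\<Sum>i\<in>UNIV. cnj (S i x y) * P i x y / normsq i) = 0"
  "(\<Sum>i\<in>UNIV. cnj (S i x y) * Q i x y / normsq i) = 0"
  "(\<Sum>i\<in>UNIV. cnj (S i x y) * S i x y / normsq i) = 1"
proof -
  define A :: "complex^3^3" where "A = (\<chi> i. vector [P i x y, Q i x y, S i x y])"
  define c :: "complex^3" where "c = vector [Vi y, Vi y, 1]"
  have A: "A$i$1 = P i x y" "A$i$2 = Q i x y" "A$i$3 = S i x y" for i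
    by (simp_all add: A_def)
  have c: "c$1 = Vi y" "c$2 = Vi y" "c$3 = 1" by (simp_all add: c_def)
  have "(\<Sum>a\<in>UNIV. c$a * A$i$a * cnj (A$j$a)) = (if i = j then normsq i else 0)" for i j
    unfolding pairing_rows[of i x y j, symmetric] sum_3 A c pairing_def
    by (simp only: algebra_simps mult_1)
  from weighted_orthogonal_rows[where c = "\<lambda>a. c$a", OF this normsq_nonzero]
  have *: "c$a * (\<Sum>i\<in>UNIV. cnj (A$i$a) * A$i$b / normsq i) = (if a = b then 1 else 0)" for a b .
  have neq: "(1::3) \<noteq> 2" "(1::3) \<noteq> 3" "(2::3) \<noteq> 3" "(2::3) \<noteq> 1" "(3::3) \<noteq> 1" "(3::3) \<noteq> 2" by simp_all
  show "Vi y * (\<Sum>i\<in>UNIV. cnj (P i x y) * P i x y / normsq i) = 1"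
       "Vi y * (\<Sum>i\<in>UNIV. cnj (P i x y) * Q i x y / normsq i) = 0"
       "Vi y * (\<Sum>i\<in>UNIV. cnj (P i x y) * S i x y / normsq i) = 0"
       "Vi y * (\<Sum>i\<in>UNIV. cnj (Q i x y) * P i x y / normsq i) = 0"
       "Vi y * (\<Sum>i\<in>UNIV. cnj (Q i x y) * Q i x y / normsq i) = 1"
       "Vi y * (\<Sum>i\<in>UNIV. cnj (Q i x y) * S i x y / normsq i) = 0"
       "(\<Sum>i\<in>UNIV. cnj (S i x y) * P i x y / normsq i) = 0"
       "(\<Sum>i\<in>UNIV. cnj (S i x y) * Q i x y / normsq i) = 0"
       "(\<Sum>i\<in>UNIV. cnj (S i x y) * S i x y / normsq i) = 1"
    using *[of 1 1] *[of 1 2] *[of 1 3] *[of 2 1] *[of 2 2] *[of 2 3] *[of 3 1] *[of 3 2] *[of 3 3]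
    unfolding A c by (simp_all only: neq simp_thms if_True if_False mult_1)
qed

text \<open>
  Pointwise this is \<open>completeness\<close>; the coefficients do not depend on the point by \<open>pairing_constant\<close>.
\<close>

lemma expansion:
  assumes "frame_row p q s"
  defines "\<gamma> \<equiv> \<lambda>i. pairing (p 0 0) (q 0 0) (s 0 0) (P i 0 0) (Q i 0 0) (S i 0 0) 0 / normsq i"
  shows "p x y = (\<Sum>i\<in>UNIV. \<gamma> i * P i x y)"
    and "q x y = (\<Sum>i\<in>UNIV. \<gamma> i * Q i x y)"
    and "s x y = (\<Sum>i\<in>UNIV. \<gamma> i * S i x y)"
proof -
  have \<gamma>: "\<gamma> i = (Vi y * (p x y * cnj (P i x y) + q x y * cnj (Q i x y)) + s x y * cnj (S i x y)) / normsq i" for i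
    using pairing_constant[OF assms(1) rows[of i], where x = x and y = y] unfolding \<gamma>_def pairing_def by simp
  have "(\<Sum>i\<in>UNIV. \<gamma> i * W i) =
      p x y * (Vi y * (\<Sum>i\<in>UNIV. cnj (P i x y) * W i / normsq i))
    + q x y * (Vi y * (\<Sum>i\<in>UNIV. cnj (Q i x y) * W i / normsq i))
    + s x y * (\<Sum>i\<in>UNIV. cnj (S i x y) * W i / normsq i)" for W
    unfolding \<gamma> sum_distrib_left sum.distrib[symmetric]
    by (intro sum.cong refl) (simp add: field_simps)
  from this[of "\<lambda>i. P i x y"] this[of "\<lambda>i. Q i x y"] this[of "\<lambda>i. S i x y"]
  show "p x y = (\<Sum>i\<in>UNIV. \<gamma> i * P i x y)"
    and "q x y = (\<Sum>i\<in>UNIV. \<gamma> i * Q i x y)"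
    and "s x y = (\<Sum>i\<in>UNIV. \<gamma> i * S i x y)"
    unfolding completeness by simp_all
qed

text \<open>
  The \<open>d\<close>-weighted sums reduce to \<open>completeness\<close> because \<open>d s = p + q\<close>. The third one recovers the conformal
  factor from the homogeneous coordinates of the immersion.
\<close>

lemma moments:
  "(\<Sum>i\<in>UNIV. cnj (S i x y) * S i x y / normsq i) = 1"
  "(\<Sum>i\<in>UNIV. d i * (cnj (S i x y) * S i x y / normsq i)) = 0"
  "(\<Sum>i\<in>UNIV. (d i)\<^sup>2 * (cnj (S i x y) * S i x y / normsq i)) = 2 * V y"
proof -
  show "(\<Sum>i\<in>UNIV. cnj (S i x y) * S i x y / normsq i) = 1" by (rule completeness)
  have "(\<Sum>i\<in>UNIV. d i * (cnj (S i x y) * S i x y / normsq i)) =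
     (\<Sum>i\<in>UNIV. cnj (S i x y) * P i x y / normsq i) + (\<Sum>i\<in>UNIV. cnj (S i x y) * Q i x y / normsq i)"
    unfolding sum.distrib[symmetric]
    by (intro sum.cong refl) (simp add: add_divide_distrib[symmetric] distrib_left[symmetric] eigen_sum)
  thus "(\<Sum>i\<in>UNIV. d i * (cnj (S i x y) * S i x y / normsq i)) = 0" unfolding completeness by simp
  have *: "(d i)\<^sup>2 * (cnj (S i x y) * S i x y / normsq i) = cnj (P i x y) * P i x y / normsq i + cnj (P i x y) * Q i x y / normsq i
      + (cnj (Q i x y) * P i x y / normsq i + cnj (Q i x y) * Q i x y / normsq i)" for i
  proof -
    have "(d i)\<^sup>2 * (cnj (S i x y) * S i x y / normsq i) = cnj (d i * S i x y) * (d i * S i x y) / normsq i"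
      by (simp add: power2_eq_square)
    also have "\<dots> = cnj (P i x y + Q i x y) * (P i x y + Q i x y) / normsq i" by (simp only: eigen_sum)
    finally show ?thesis by (simp add: algebra_simps add_divide_distrib)
  qed
  have "Vi y * (\<Sum>i\<in>UNIV. (d i)\<^sup>2 * (cnj (S i x y) * S i x y / normsq i)) = 2"
    unfolding * sum.distrib distrib_left completeness by simp
  hence "V y * (Vi y * (\<Sum>i\<in>UNIV. (d i)\<^sup>2 * (cnj (S i x y) * S i x y / normsq i))) = 2 * V y"
    by simp
  thus "(\<Sum>i\<in>UNIV. (d i)\<^sup>2 * (cnj (S i x y) * S i x y / normsq i)) = 2 * V y"
    unfolding mult.assoc[symmetric] V_Vi by simp
qed

text \<open>
  If one coordinate vanishes, the three moment equations are overdetermined for the other two.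
\<close>

lemma V_if_S_zero:
  assumes "S i x y = 0" "UNIV = {i, j, k}" "i \<noteq> j" "i \<noteq> k" "j \<noteq> k"
  shows "2 * V y = - of_real (d j * d k)"
proof -
  have *: "(\<Sum>m\<in>UNIV. g m) = g i + g j + g k" for g :: "3 \<Rightarrow> complex"
    unfolding assms(2) using assms(3-) by (simp add: add.assoc)
  show ?thesis using moments[of x y] unfolding * assms(1)
    by (simp only: mult_zero_right mult_zero_left div_0 add_0_left of_real_mult of_real_power) algebra
qed

text \<open>
  A coordinate vanishes only where \<open>exp u\<close> takes one of three values, and the non-constant continuous function
  \<open>u\<close> cannot have a finite range.
\<close>

lemma all_S_nonzero_somewhere: "\<exists>y. \<forall>i. S i 0 y \<noteq> 0"
proof (rule ccontr)
  assume "\<not> ?thesis"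
  hence ex: "\<exists>i. S i 0 y = 0" for y by blast
  have "u y \<in> ln ` {- (d 2 * d 3) / 2, - (d 1 * d 3) / 2, - (d 1 * d 2) / 2}" for y
  proof -
    from ex obtain i where i: "S i 0 y = 0" by blast
    have U: "UNIV = {1, 2, 3 :: 3}" "UNIV = {2, 1, 3 :: 3}" "UNIV = {3, 1, 2 :: 3}"
      using exhaust_3 by auto
    have "2 * V y = of_real (2 * exp (u y))" by (simp add: V_def)
    moreover have "2 * V y = of_real (- (d 2 * d 3)) \<or> 2 * V y = of_real (- (d 1 * d 3))
        \<or> 2 * V y = of_real (- (d 1 * d 2))"
      using exhaust_3[of i] V_if_S_zero[OF _ U(1)] V_if_S_zero[OF _ U(2)] V_if_S_zero[OF _ U(3)] i
      by fastforce
    ultimately have "2 * exp (u y) \<in> {- (d 2 * d 3), - (d 1 * d 3), - (d 1 * d 2)}"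
      by (metis insert_iff of_real_eq_iff)
    hence "exp (u y) \<in> {- (d 2 * d 3) / 2, - (d 1 * d 3) / 2, - (d 1 * d 2) / 2}" by auto
    thus ?thesis by (metis image_eqI ln_exp)
  qed
  hence "range u \<subseteq> ln ` {- (d 2 * d 3) / 2, - (d 1 * d 3) / 2, - (d 1 * d 2) / 2}" by blast
  hence "finite (range u)" by (rule finite_subset) simp
  moreover have "continuous_on UNIV u"
    using u_deriv DERIV_continuous_on by (metis has_field_derivative_at_within)
  ultimately have "u constant_on UNIV"
    by (intro continuous_finite_range_constant) auto
  thus False using profile by (simp add: tzitzeica_profile_def)
qed

end

section \<open>Monodromy over one period of the conformal factor\<close>

locale periodic_eigenframe = eigenframe +
  fixes T :: real
  assumes period: "smallest_period u (2 * T)"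
begin

lemma u_periodic: "u (y + 2 * T) = u y"
  using period by (simp add: smallest_period_def)

lemma T_pos: "T > 0"
  using period by (simp add: smallest_period_def)

text \<open>
  The coefficient of an eigenrow in the expansion of its own shift by \<open>2 T\<close>.
\<close>

definition multiplier :: "3 \<Rightarrow> complex" where
  "multiplier i = pairing (P i 0 (2 * T)) (Q i 0 (2 * T)) (S i 0 (2 * T)) (P i 0 0) (Q i 0 0) (S i 0 0) 0 / normsq i"

text \<open>
  The shifted eigenrow is a solution whose value at \<open>0\<close> lies in the same eigenspace, so in its expansion only
  one coefficient survives.
\<close>

lemma monodromy:
  "P i x (y + 2 * T) = multiplier i * P i x y"
  "Q i x (y + 2 * T) = multiplier i * Q i x y"
  "S i x (y + 2 * T) = multiplier i * S i x y"
proof -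
  note sh = frame_row_shift[OF u_periodic rows, of i]
  have co: "E (2 * T) = E 0" "V (2 * T) = V 0" "Vi (2 * T) = Vi 0"
    using coeffs_shift[OF u_periodic, of 0] by simp_all
  have ei: "eigen_triple (d i) 0 (P i 0 (2 * T)) (Q i 0 (2 * T)) (S i 0 (2 * T))"
    using eigen[of i "2 * T" 0] unfolding eigen_triple_def co .
  have z: "pairing (P i 0 (2 * T)) (Q i 0 (2 * T)) (S i 0 (2 * T)) (P j 0 0) (Q j 0 0) (S j 0 0) 0 / normsq j =
     (if j = i then multiplier i else 0)" for j
  proof (cases "j = i")
    case False
    hence "d i \<noteq> d j" using d_inj by (auto dest: injD)
    thus ?thesis using False eigen_triples_orthogonal[OF ei eigen_at_0] by simp
  qed (simp add: multiplier_def)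
  show "P i x (y + 2 * T) = multiplier i * P i x y"
    using expansion(1)[OF sh, of x y] by (simp add: z if_distrib[of "\<lambda>a. a * _"] cong: if_cong)
  show "Q i x (y + 2 * T) = multiplier i * Q i x y"
    using expansion(2)[OF sh, of x y] by (simp add: z if_distrib[of "\<lambda>a. a * _"] cong: if_cong)
  show "S i x (y + 2 * T) = multiplier i * S i x y"
    using expansion(3)[OF sh, of x y] by (simp add: z if_distrib[of "\<lambda>a. a * _"] cong: if_cong)
qed

lemma multiplier_unimodular: "multiplier i * cnj (multiplier i) = 1"
proof -
  have co: "Vi (2 * T) = Vi 0" using u_periodic[of 0] by (simp add: Vi_def)
  have "pairing (P i 0 (0 + 2 * T)) (Q i 0 (0 + 2 * T)) (S i 0 (0 + 2 * T)) (P i 0 (0 + 2 * T)) (Q i 0 (0 + 2 * T)) (S i 0 (0 + 2 * T)) (2 * T) = normsq i"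
    using pairing_rows[of i 0 "2 * T" i] by simp
  hence "multiplier i * cnj (multiplier i) * normsq i = normsq i"
    unfolding monodromy pairing_def co normsq_def by (simp add: algebra_simps)
  thus ?thesis by simp
qed

lemma monodromy_int:
  assumes "multiplier i = cis \<theta>"
  shows "S i x (y + 2 * T * of_int k) = cis (of_int k * \<theta>) * S i x y"
proof (induction k rule: int_induct[where k = 0])
  case base
  show ?case by simp
next
  case (step1 k)
  have "y + 2 * T * of_int (k + 1) = y + 2 * T * of_int k + 2 * T" by (simp add: algebra_simps)
  hence "S i x (y + 2 * T * of_int (k + 1)) = cis \<theta> * S i x (y + 2 * T * of_int k)"
    using monodromy(3) assms by metis
  also have "\<dots> = (cis \<theta> * cis (of_int k * \<theta>)) * S i x y" unfolding step1 by (rule mult.assoc[symmetric])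
  also have "cis \<theta> * cis (of_int k * \<theta>) = cis (of_int (k + 1) * \<theta>)"
    by (simp add: cis_mult distrib_right add.commute)
  finally show ?case .
next
  case (step2 k)
  have "y + 2 * T * of_int k = y + 2 * T * of_int (k - 1) + 2 * T" by (simp add: algebra_simps)
  hence "S i x (y + 2 * T * of_int k) = cis \<theta> * S i x (y + 2 * T * of_int (k - 1))"
    using monodromy(3) assms by metis
  hence "S i x (y + 2 * T * of_int (k - 1)) = cis (- \<theta>) * (cis (of_int k * \<theta>) * S i x y)"
    unfolding step2 by (simp add: mult.assoc[symmetric] cis_mult)
  also have "\<dots> = (cis (- \<theta>) * cis (of_int k * \<theta>)) * S i x y" by (rule mult.assoc[symmetric])
  also have "cis (- \<theta>) * cis (of_int k * \<theta>) = cis (of_int (k - 1) * \<theta>)"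
    by (simp add: cis_mult left_diff_distrib)
  finally show ?case .
qed

text \<open>
  A real eigenrow stays real along the \<open>y\<close>-axis, so its multiplier is both real and unimodular.
\<close>

lemma multiplier_real:
  assumes "cnj \<kappa> = \<kappa>" and "cnj (P i 0 0) = P i 0 0" "cnj (Q i 0 0) = Q i 0 0" "cnj (S i 0 0) = S i 0 0"
  shows "\<exists>k::int. multiplier i = cis (pi * of_int k)"
proof -
  note r = frame_row_real[OF assms(1) rows assms(2-4), of "2 * T"]
  have "cnj (multiplier i) = multiplier i"
    unfolding multiplier_def normsq_def pairing_def complex_cnj_divide complex_cnj_add complex_cnj_mult r assms(2-4)
      cnj_coeffs ..
  hence "multiplier i * multiplier i = 1" using multiplier_unimodular[of i] by simp
  hence "multiplier i = 1 \<or> multiplier i = -1" by (metis square_eq_1_iff)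
  thus ?thesis
  proof
    assume "multiplier i = 1"
    thus ?thesis by (intro exI[of _ 0]) simp
  next
    assume "multiplier i = -1"
    thus ?thesis by (intro exI[of _ 1]) simp
  qed
qed

text \<open>
  Integrating \<open>eigen_triple_log_derivative\<close> over one period gives the logarithm of the multiplier. A combination that
  annihilates \<open>1\<close> and \<open>d\<close> sees only the leading term \<open>- d\<^sup>2\<close> of the quadratic polynomial, and the integral that is
  left is the conjugate of \<open>beta2\<close>.
\<close>

lemma monodromy_phases:
  assumes nonreal: "cnj \<kappa> \<noteq> \<kappa>"
  obtains \<theta> where "\<And>i. multiplier i = cis (\<theta> i)"
    and "\<forall>c :: 3 \<Rightarrow> real. (\<Sum>i\<in>UNIV. c i) = 0 \<longrightarrow> (\<Sum>i\<in>UNIV. c i * d i) = 0 \<longrightarrow>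
      (\<Sum>i\<in>UNIV. c i * \<theta> i) = (\<Sum>i\<in>UNIV. c i * (d i)\<^sup>2) * Im (beta2 \<psi> u (2 * T) l)"
proof -
  let ?J = "{0..2 * T}"
  define g where "g i y = cnj (beta2_integrand y) * (2 * V y - (d i)\<^sup>2 - d i * Re \<kappa> * Vi y)" for i y
  have gc: "continuous_on ?J (g i)" for i
    unfolding g_def[abs_def] by (intro continuous_intros coeffs_continuous beta2_integrand_continuous nonreal)
  define G where "G i y = integral {0..y} (g i)" for i y
  have dG: "(G i has_vector_derivative g i y) (at y within ?J)" if "y \<in> ?J" for i y
    unfolding G_def[abs_def] using integral_has_vector_derivative[OF gc that] .
  \<comment> \<open>If \<open>s\<close> vanishes, so do \<open>q - p\<close> by the slope equation and \<open>p + q = d s\<close>.\<close>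
  have S0: "S i 0 0 \<noteq> 0" for i
  proof
    assume 0: "S i 0 0 = 0"
    have "Q i 0 0 - P i 0 0 = 0" using eigen_triple_log_derivative[OF eigen_at_0[of i] nonreal] 0 by simp
    moreover have "P i 0 0 + Q i 0 0 = 0" using eigen_sum[of i 0 0] 0 by simp
    ultimately have "P i 0 0 = 0" "Q i 0 0 = 0" by (simp_all add: add_eq_0_iff)
    thus False using nontrivial 0 by blast
  qed
  have mG: "multiplier i = exp (G i (2 * T))" for i
  proof -
    have "((\<lambda>y. S i 0 y * exp (- G i y)) has_vector_derivative 0) (at y within ?J)" if y: "y \<in> ?J" for y
    proof -
      have "(S i 0 has_vector_derivative g i y * S i 0 y) (at y within ?J)"
        using frame_rowD(6)[OF rows, of i 0 y] eigen_triple_log_derivative[OF eigen nonreal, of i 0 y]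
        by (simp add: g_def has_vector_derivative_at_within)
      moreover have "((\<lambda>y. exp (- G i y)) has_vector_derivative (- g i y) * exp (- G i y)) (at y within ?J)"
        using field_vector_diff_chain_within[OF has_vector_derivative_minus[OF dG[OF y]] DERIV_subset[OF DERIV_exp]]
        by (simp add: o_def)
      ultimately show ?thesis
        by (rule has_vector_derivative_eq_rhs[OF has_vector_derivative_mult]) (simp add: algebra_simps)
    qed
    then obtain k where k: "\<And>y. y \<in> ?J \<Longrightarrow> S i 0 y * exp (- G i y) = k"
      using has_vector_derivative_zero_constant[of ?J "\<lambda>y. S i 0 y * exp (- G i y)"] by auto
    have "S i 0 (2 * T) * exp (- G i (2 * T)) = S i 0 0"
      using k[of 0] k[of "2 * T"] T_pos by (simp add: G_def)
    moreover have "S i 0 (2 * T) = multiplier i * S i 0 0" using monodromy(3)[of i 0 0] by simp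
    ultimately have "multiplier i * exp (- G i (2 * T)) = 1" using S0[of i] by simp
    thus ?thesis by (simp add: exp_minus field_simps)
  qed
  define \<theta> where "\<theta> i = Im (G i (2 * T))" for i
  show thesis
  proof (rule that[of \<theta>], goal_cases)
    case (1 i)
    have "(cmod (multiplier i))\<^sup>2 = 1" using multiplier_unimodular[of i] by (metis complex_norm_square of_real_eq_1_iff)
    hence "cmod (multiplier i) = 1" by (simp add: abs_square_eq_1)
    hence "exp (Re (G i (2 * T))) = 1" unfolding mG norm_exp_eq_Re .
    thus ?case unfolding mG exp_eq_polar \<theta>_def by simp
  next
    case 2
    show ?case
    proof (intro allI impI)
      fix c :: "3 \<Rightarrow> real"
      assume c: "(\<Sum>i\<in>UNIV. c i) = 0" "(\<Sum>i\<in>UNIV. c i * d i) = 0"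
      let ?K = "\<Sum>i\<in>UNIV. c i * (d i)\<^sup>2"
      have gi: "(g i has_integral G i (2 * T)) ?J" for i
        unfolding G_def by (intro integrable_integral integrable_continuous_interval gc)
      have "((\<lambda>y. \<Sum>i\<in>UNIV. c i *\<^sub>R g i y) has_integral (\<Sum>i\<in>UNIV. c i *\<^sub>R G i (2 * T))) ?J"
        by (intro has_integral_sum has_integral_cmul gi) simp
      moreover have "(\<Sum>i\<in>UNIV. c i *\<^sub>R g i y) = - ?K *\<^sub>R cnj (beta2_integrand y)" for y
      proof -
        have "(\<Sum>i\<in>UNIV. c i *\<^sub>R g i y) =
           cnj (beta2_integrand y) * (of_real (\<Sum>i\<in>UNIV. c i) * (2 * V y) - of_real ?K
              - of_real (\<Sum>i\<in>UNIV. c i * d i) * (Re \<kappa> * Vi y))"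
          unfolding of_real_sum sum_distrib_right sum_subtractf[symmetric] sum_distrib_left
          by (intro sum.cong refl) (simp add: g_def scaleR_conv_of_real algebra_simps)
        thus ?thesis unfolding c by (simp add: scaleR_conv_of_real)
      qed
      moreover have "beta2 \<psi> u (2 * T) l = integral ?J beta2_integrand"
        unfolding beta2_eq zero_ereal_def using T_pos
        by (intro interval_integral_eq_integral borel_integrable_atLeastAtMost' beta2_integrand_continuous nonreal) auto
      hence "(beta2_integrand has_integral beta2 \<psi> u (2 * T) l) ?J"
        using integrable_continuous_interval[OF beta2_integrand_continuous[OF nonreal]] by (simp add: integrable_integral)
      hence "((\<lambda>y. - ?K *\<^sub>R cnj (beta2_integrand y)) has_integral - ?K *\<^sub>R cnj (beta2 \<psi> u (2 * T) l)) ?J"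
        by (intro has_integral_cmul has_integral_linear[OF _ bounded_linear_cnj, unfolded o_def])
      ultimately have "(\<Sum>i\<in>UNIV. c i *\<^sub>R G i (2 * T)) = - ?K *\<^sub>R cnj (beta2 \<psi> u (2 * T) l)"
        using has_integral_unique by auto
      hence "Im (\<Sum>i\<in>UNIV. c i *\<^sub>R G i (2 * T)) = Im (- ?K *\<^sub>R cnj (beta2 \<psi> u (2 * T) l))" by (rule arg_cong)
      thus "(\<Sum>i\<in>UNIV. c i * \<theta> i) = ?K * Im (beta2 \<psi> u (2 * T) l)"
        unfolding \<theta>_def by simp
    qed
  qed
qed

end

section \<open>Periods of the immersion\<close>

context periodic_eigenframe
begin

lemma u_periodic_int: "u (y + 2 * T * of_int k) = u y"
proof (induction k rule: int_induct[where k = 0])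
  case base
  show ?case by simp
next
  case (step1 k)
  have "y + 2 * T * of_int (k + 1) = y + 2 * T * of_int k + 2 * T" by (simp add: algebra_simps)
  thus ?case using u_periodic[of "y + 2 * T * of_int k"] step1 by metis
next
  case (step2 k)
  have "y + 2 * T * of_int k = y + 2 * T * of_int (k - 1) + 2 * T" by (simp add: algebra_simps)
  thus ?case using u_periodic[of "y + 2 * T * of_int (k - 1)"] step2 by metis
qed

lemma period_multiple:
  assumes "\<And>y. u (y + b) = u y"
  obtains k :: int where "b = 2 * T * of_int k"
proof -
  define k where "k = \<lfloor>b / (2 * T)\<rfloor>"
  define c where "c = b - 2 * T * of_int k"
  have "of_int k \<le> b / (2 * T)" "b / (2 * T) < of_int k + 1" unfolding k_def by linarith+
  hence c: "0 \<le> c" "c < 2 * T" using T_pos by (simp_all add: c_def field_simps)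
  have "u (y + c) = u y" for y
  proof -
    have "u (y + c) = u (y + c + 2 * T * of_int k)" by (rule u_periodic_int[symmetric])
    also have "y + c + 2 * T * of_int k = y + b" by (simp add: c_def)
    finally show ?thesis using assms by simp
  qed
  with c period have "c = 0" unfolding smallest_period_def by (metis less_eq_real_def not_less)
  thus thesis using that[of k] by (simp add: c_def)
qed

text \<open>
  A period of the immersion multiplies all three coordinates by a common factor. The moments bound this factor to
  the unit circle and then give \<open>u\<close> the period \<open>Im \<omega>\<close>; conversely every column entry of the frame is a fixed
  combination of the coordinates.
\<close>

lemma line_period_iff:
  assumes F: "extended_frame \<psi> u l F"
    and S: "\<And>i x y. S i x y = (\<Sum>b\<in>UNIV. \<rho> i $ b * F (Complex x y) $ b $ 3)"
    and \<theta>: "\<And>i. multiplier i = cis (\<theta> i)"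
  shows "(\<forall>z. immersion_of F (z + \<omega>) = immersion_of F z) \<longleftrightarrow>
    (\<exists>k::int. Im \<omega> = 2 * T * of_int k \<and> (\<exists>c. \<forall>i. cis (d i * Re \<omega> + of_int k * \<theta> i) = c))"
proof -
  define e where "e z = F z *v axis 3 1" for z
  have e: "e z $ b = F z $ b $ 3" for z b
    by (simp add: e_def matrix_vector_mult_def axis_def if_distrib cong: if_cong)
  have S': "S i (Re z) (Im z) = (\<Sum>b\<in>UNIV. \<rho> i $ b * e z $ b)" for i z
    unfolding S e by simp
  have enz: "e z \<noteq> 0" for z
  proof
    assume "e z = 0"
    hence "S i (Re z) (Im z) = 0" for i unfolding S' by simp
    thus False using moments(1)[of "Re z" "Im z"] by simp
  qed
  have eq: "immersion_of F z = immersion_of F w \<longleftrightarrow> (\<exists>c. c \<noteq> 0 \<and> e z = c *s e w)" for z w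
    unfolding immersion_of_def e_def[symmetric] by (rule proj_point_eq_iff[OF enz enz])
  have shift: "S i (Re (z + \<omega>)) (Im (z + \<omega>)) = cis (d i * Re \<omega> + of_int k * \<theta> i) * S i (Re z) (Im z)"
    if "Im \<omega> = 2 * T * of_int k" for i z k
  proof -
    have "S i (Re (z + \<omega>)) (Im (z + \<omega>)) = cis (of_int k * \<theta> i) * S i (Re z + Re \<omega>) (Im z)"
      using monodromy_int[OF \<theta>, of i "Re (z + \<omega>)" "Im z" k] by (simp add: that)
    also have "S i (Re z + Re \<omega>) (Im z) = (cis (d i * Re \<omega>) * cis (d i * Re z)) * S i 0 (Im z)"
      by (subst S_translation) (simp add: cis_mult distrib_left add.commute)
    also have "\<dots> = cis (d i * Re \<omega>) * S i (Re z) (Im z)"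
      by (subst (2) S_translation) (rule mult.assoc)
    finally show ?thesis by (simp add: cis_mult mult.assoc[symmetric] add.commute)
  qed
  show ?thesis
  proof
    assume L: "\<forall>z. immersion_of F (z + \<omega>) = immersion_of F z"
    have par: "\<exists>c. \<forall>i. S i (Re (z + \<omega>)) (Im (z + \<omega>)) = c * S i (Re z) (Im z)" for z
    proof -
      obtain c where "e (z + \<omega>) = c *s e z" using L eq by blast
      thus ?thesis unfolding S' by (intro exI[of _ c]) (simp add: sum_distrib_left mult_ac)
    qed
    have "u (y + Im \<omega>) = u y" for y
    proof -
      obtain c where c: "\<And>i. S i (Re \<omega>) (y + Im \<omega>) = c * S i 0 y"
        using par[of "Complex 0 y"] by auto
      \<comment> \<open>The common factor \<open>c\<close> scales every moment by \<open>\<bar>c\<bar>\<^sup>2\<close>; comparing the first gives \<open>\<bar>c\<bar> = 1\<close>.\<close>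
      have scale: "(\<Sum>i\<in>UNIV. w i * (cnj (S i (Re \<omega>) (y + Im \<omega>)) * S i (Re \<omega>) (y + Im \<omega>) / normsq i))
          = (cnj c * c) * (\<Sum>i\<in>UNIV. w i * (cnj (S i 0 y) * S i 0 y / normsq i))" for w
        unfolding c sum_distrib_left by (simp add: mult_ac)
      have "cnj c * c = 1"
        using scale[of "\<lambda>_. 1"] by (simp add: moments(1))
      hence "2 * V (y + Im \<omega>) = 2 * V y"
        using scale[of "\<lambda>i. (of_real (d i))\<^sup>2"] unfolding of_real_power[symmetric] by (simp only: moments(3) mult_1)
      thus ?thesis by (simp add: V_def)
    qed
    then obtain k :: int where k: "Im \<omega> = 2 * T * of_int k" using period_multiple by blast
    obtain y where y: "\<And>i. S i 0 y \<noteq> 0" using all_S_nonzero_somewhere by blast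
    obtain c where "\<And>i. S i (Re (Complex 0 y + \<omega>)) (Im (Complex 0 y + \<omega>)) = c * S i 0 y"
      using par[of "Complex 0 y"] by auto
    hence "cis (d i * Re \<omega> + of_int k * \<theta> i) * S i 0 y = c * S i 0 y" for i
      unfolding shift[OF k] by simp
    hence "\<forall>i. cis (d i * Re \<omega> + of_int k * \<theta> i) = c" using y by simp
    with k show "\<exists>k::int. Im \<omega> = 2 * T * of_int k \<and> (\<exists>c. \<forall>i. cis (d i * Re \<omega> + of_int k * \<theta> i) = c)"
      by blast
  next
    assume "\<exists>k::int. Im \<omega> = 2 * T * of_int k \<and> (\<exists>c. \<forall>i. cis (d i * Re \<omega> + of_int k * \<theta> i) = c)"
    then obtain k :: int and c where k: "Im \<omega> = 2 * T * of_int k"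
      and c: "\<And>i. cis (d i * Re \<omega> + of_int k * \<theta> i) = c" by blast
    have "e (z + \<omega>) $ b = c * e z $ b" for z b
    proof -
      obtain \<gamma> where \<gamma>: "\<And>x y. F (Complex x y) $ b $ 3 = (\<Sum>i\<in>UNIV. \<gamma> i * S i x y)"
        by (rule that, rule expansion(3)[OF frame_rows[OF F, of b]])
      have "e (z + \<omega>) $ b = (\<Sum>i\<in>UNIV. \<gamma> i * S i (Re (z + \<omega>)) (Im (z + \<omega>)))"
        using \<gamma>[of "Re (z + \<omega>)" "Im (z + \<omega>)"] by (simp only: e complex_surj)
      also have "\<dots> = c * (\<Sum>i\<in>UNIV. \<gamma> i * S i (Re z) (Im z))"
        unfolding shift[OF k] c sum_distrib_left by (simp add: mult_ac)
      also have "(\<Sum>i\<in>UNIV. \<gamma> i * S i (Re z) (Im z)) = e z $ b"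
        using \<gamma>[of "Re z" "Im z"] by (simp only: e complex_surj)
      finally show ?thesis .
    qed
    hence "e (z + \<omega>) = c *s e z" for z by (simp add: vec_eq_iff)
    moreover have "c \<noteq> 0" using c[of 1] by (metis cis_neq_zero)
    ultimately show "\<forall>z. immersion_of F (z + \<omega>) = immersion_of F z" unfolding eq by blast
  qed
qed

text \<open>
  By \<open>line_period_iff\<close> the periods are pairs of a real translation and an integer, subject to two congruences
  modulo \<open>2 \<pi>\<close> for the differences with the third coordinate.
\<close>

lemma descends_iff:
  assumes F: "extended_frame \<psi> u l F"
    and S: "\<And>i x y. S i x y = (\<Sum>b\<in>UNIV. \<rho> i $ b * F (Complex x y) $ b $ 3)"
    and \<theta>: "\<And>i. multiplier i = cis (\<theta> i)"
  shows "descends_to_torus (immersion_of F) \<longleftrightarrow>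
    (d 1 - d 3) / (d 2 - d 3) \<in> \<rat> \<and>
    ((\<theta> 1 - \<theta> 3) - (d 1 - d 3) / (d 2 - d 3) * (\<theta> 2 - \<theta> 3)) / (2 * pi) \<in> \<rat>"
proof -
  define per where "per a k \<longleftrightarrow> (\<exists>j::int. (d 1 - d 3) * a + of_int k * (\<theta> 1 - \<theta> 3) = 2 * pi * of_int j) \<and>
     (\<exists>j::int. (d 2 - d 3) * a + of_int k * (\<theta> 2 - \<theta> 3) = 2 * pi * of_int j)" for a and k :: int
  have per: "(\<exists>c. \<forall>i. cis (d i * a + of_int k * \<theta> i) = c) \<longleftrightarrow> per a k" for a k
  proof -
    have "(\<exists>c. \<forall>i. cis (d i * a + of_int k * \<theta> i) = c) \<longleftrightarrow>
      cis (d 1 * a + of_int k * \<theta> 1) = cis (d 3 * a + of_int k * \<theta> 3) \<and>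
      cis (d 2 * a + of_int k * \<theta> 2) = cis (d 3 * a + of_int k * \<theta> 3)"
      unfolding forall_3 by metis
    thus ?thesis unfolding cis_eq_iff per_def by (simp add: algebra_simps)
  qed
  note iff = line_period_iff[OF F S \<theta>, unfolded per]
  have "descends_to_torus (immersion_of F) \<longleftrightarrow>
      (\<exists>\<omega>1 \<omega>2. Re \<omega>1 * Im \<omega>2 \<noteq> Re \<omega>2 * Im \<omega>1 \<and>
        (\<exists>k::int. Im \<omega>1 = 2 * T * of_int k \<and> per (Re \<omega>1) k) \<and>
        (\<exists>k::int. Im \<omega>2 = 2 * T * of_int k \<and> per (Re \<omega>2) k))"
    unfolding descends_to_torus_def iff independent_complex_pair_iff[symmetric] by blast
  also have "\<dots> \<longleftrightarrow> (\<exists>a1 n1 a2 n2. a1 * of_int n2 \<noteq> a2 * of_int n1 \<and> per a1 n1 \<and> per a2 n2)"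
  proof
    assume "\<exists>\<omega>1 \<omega>2. Re \<omega>1 * Im \<omega>2 \<noteq> Re \<omega>2 * Im \<omega>1 \<and>
        (\<exists>k::int. Im \<omega>1 = 2 * T * of_int k \<and> per (Re \<omega>1) k) \<and>
        (\<exists>k::int. Im \<omega>2 = 2 * T * of_int k \<and> per (Re \<omega>2) k)"
    then obtain \<omega>1 \<omega>2 and k1 k2 :: int where *: "Re \<omega>1 * Im \<omega>2 \<noteq> Re \<omega>2 * Im \<omega>1"
      "Im \<omega>1 = 2 * T * of_int k1" "per (Re \<omega>1) k1" "Im \<omega>2 = 2 * T * of_int k2" "per (Re \<omega>2) k2"
      by blast
    hence "Re \<omega>1 * of_int k2 \<noteq> Re \<omega>2 * of_int k1" by auto
    with * show "\<exists>a1 n1 a2 n2. a1 * of_int n2 \<noteq> a2 * of_int n1 \<and> per a1 n1 \<and> per a2 n2" by blast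
  next
    assume "\<exists>a1 n1 a2 n2. a1 * of_int n2 \<noteq> a2 * of_int n1 \<and> per a1 n1 \<and> per a2 n2"
    then obtain a1 n1 a2 n2 where *: "a1 * of_int n2 \<noteq> a2 * of_int n1" "per a1 n1" "per a2 n2" by blast
    show "\<exists>\<omega>1 \<omega>2. Re \<omega>1 * Im \<omega>2 \<noteq> Re \<omega>2 * Im \<omega>1 \<and>
        (\<exists>k::int. Im \<omega>1 = 2 * T * of_int k \<and> per (Re \<omega>1) k) \<and>
        (\<exists>k::int. Im \<omega>2 = 2 * T * of_int k \<and> per (Re \<omega>2) k)"
      using * T_pos
      by (intro exI[of _ "Complex a1 (2 * T * of_int n1)"] exI[of _ "Complex a2 (2 * T * of_int n2)"]) auto
  qed
  also have "\<dots> \<longleftrightarrow> (d 1 - d 3) / (d 2 - d 3) \<in> \<rat> \<and>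
    ((\<theta> 1 - \<theta> 3) - (d 1 - d 3) / (d 2 - d 3) * (\<theta> 2 - \<theta> 3)) / (2 * pi) \<in> \<rat>"
    unfolding per_def by (rule rank_two_period_lattice_iff) (use d_inj in \<open>auto dest: injD\<close>)
  finally show ?thesis .
qed

end

section \<open>The closing condition\<close>

theorem theorem6p6:
  fixes \<psi> l\<^sub>0 :: complex
    and u :: "real \<Rightarrow> real"
    and T d\<^sub>1 d\<^sub>2 d\<^sub>3 :: real
    and F :: "complex \<Rightarrow> complex^3^3"
    and f :: "complex \<Rightarrow> (complex^3) set"
  assumes "\<psi> \<noteq> 0"
    and "tzitzeica_profile \<psi> u"
    and "smallest_period u (2 * T)"
    and "cmod l\<^sub>0 = 1"
    and "extended_frame \<psi> u l\<^sub>0 F"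
    and "f = immersion_of F"
    and "imaginary_spectrum (potential \<psi> u l\<^sub>0) d\<^sub>1 d\<^sub>2 d\<^sub>3"
  shows "descends_to_torus f \<longleftrightarrow>
           d\<^sub>1 / d\<^sub>2 \<in> \<rat> \<and>
           (d\<^sub>1 = d\<^sub>2 \<or>
            1 / (2 * pi) * Im (beta2 \<psi> u (2 * T) l\<^sub>0) * (d\<^sub>1 * d\<^sub>2 + 2 * coeff_beta \<psi> u / 3) \<in> \<rat>)"
proof -
  interpret tzitzeica_surface \<psi> l\<^sub>0 u
    using assms(2,4) by unfold_locales
  note rel = spectrum_relations[OF assms(7)]
  have d12: "d\<^sub>1 \<noteq> d\<^sub>2" using rel by (intro spectrum_distinct)
  have d13: "d\<^sub>1 \<noteq> d\<^sub>3" using rel spectrum_distinct[of d\<^sub>1 d\<^sub>3 d\<^sub>2] by (simp add: algebra_simps)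
  have d23: "d\<^sub>2 \<noteq> d\<^sub>3" using rel spectrum_distinct[of d\<^sub>2 d\<^sub>3 d\<^sub>1] by (simp add: algebra_simps)
  define d where "d i = (vector [d\<^sub>1, d\<^sub>2, d\<^sub>3] :: real^3) $ i" for i
  have d: "d 1 = d\<^sub>1" "d 2 = d\<^sub>2" "d 3 = d\<^sub>3" by (simp_all add: d_def)
  have "inj d" unfolding inj_def forall_3 d using d12 d13 d23 by simp
  have root: "d i ^ 3 - coeff_beta \<psi> u * d i + 2 * Re \<kappa> = 0" for i
  proof -
    have "d i ^ 3 - coeff_beta \<psi> u * d i + 2 * Re \<kappa> = (d i - d\<^sub>1) * (d i - d\<^sub>2) * (d i - d\<^sub>3)"
      using rel by algebra
    thus ?thesis using exhaust_3[of i] d by auto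
  qed
  define good where "good i p q s \<rho> \<longleftrightarrow> frame_row p q s \<and> eigen_triple (d i) 0 (p 0 0) (q 0 0) (s 0 0) \<and>
      \<not> (p 0 0 = 0 \<and> q 0 0 = 0 \<and> s 0 0 = 0) \<and>
      (cnj \<kappa> = \<kappa> \<longrightarrow> cnj (p 0 0) = p 0 0 \<and> cnj (q 0 0) = q 0 0 \<and> cnj (s 0 0) = s 0 0) \<and>
      (\<forall>x y. s x y = (\<Sum>b\<in>UNIV. \<rho> $ b * F (Complex x y) $ b $ 3))" for i p q s and \<rho> :: "complex^3"
  have "\<exists>p q s \<rho>. good i p q s \<rho>" for i
  proof -
    obtain p0 q0 s0 where 0: "eigen_triple (d i) 0 p0 q0 s0" "\<not> (p0 = 0 \<and> q0 = 0 \<and> s0 = 0)"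
      "cnj \<kappa> = \<kappa> \<longrightarrow> cnj p0 = p0 \<and> cnj q0 = q0 \<and> cnj s0 = s0"
      by (rule eigen_triple_exists[OF root[of i]])
    obtain p q s and \<rho> :: "complex^3" where "frame_row p q s" "p 0 0 = p0" "q 0 0 = q0" "s 0 0 = s0"
      "\<forall>x y. s x y = (\<Sum>b\<in>UNIV. \<rho>$b * F (Complex x y)$b$3)"
      by (rule frame_row_exists[OF assms(5), of p0 q0 s0])
    with 0 show ?thesis
      by (intro exI[of _ p] exI[of _ q] exI[of _ s] exI[of _ \<rho>]) (simp add: good_def)
  qed
  then obtain P Q S \<rho> where "\<And>i. good i (P i) (Q i) (S i) (\<rho> i)" by metis
  hence PQS: "frame_row (P i) (Q i) (S i)"
      "eigen_triple (d i) 0 (P i 0 0) (Q i 0 0) (S i 0 0)"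
      "\<not> (P i 0 0 = 0 \<and> Q i 0 0 = 0 \<and> S i 0 0 = 0)"
      "cnj \<kappa> = \<kappa> \<Longrightarrow> cnj (P i 0 0) = P i 0 0 \<and> cnj (Q i 0 0) = Q i 0 0 \<and> cnj (S i 0 0) = S i 0 0"
      "S i x y = (\<Sum>b\<in>UNIV. \<rho> i $ b * F (Complex x y) $ b $ 3)" for i x y
    unfolding good_def by blast+
  interpret periodic_eigenframe \<psi> l\<^sub>0 u d P Q S T
    using PQS(1-3) \<open>inj d\<close> assms(3) by unfold_locales
  let ?r = "(d\<^sub>1 - d\<^sub>3) / (d\<^sub>2 - d\<^sub>3)"
  let ?B = "Im (beta2 \<psi> u (2 * T) l\<^sub>0)"
  let ?X = "1 / (2 * pi) * ?B * (d\<^sub>1 * d\<^sub>2 + 2 * coeff_beta \<psi> u / 3)"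
  have X: "?X = ?B / (2 * pi) * ((d\<^sub>1 - d\<^sub>3) * (d\<^sub>2 - d\<^sub>3) / 3)"
  proof -
    have "3 * (d\<^sub>1 * d\<^sub>2) + 2 * coeff_beta \<psi> u = (d\<^sub>1 - d\<^sub>3) * (d\<^sub>2 - d\<^sub>3)" using rel by algebra
    hence *: "d\<^sub>1 * d\<^sub>2 + 2 * coeff_beta \<psi> u / 3 = (d\<^sub>1 - d\<^sub>3) * (d\<^sub>2 - d\<^sub>3) / 3" by linarith
    show ?thesis unfolding * by simp
  qed
  obtain \<theta> where \<theta>: "\<And>i. multiplier i = cis (\<theta> i)" and
    link: "?r \<in> \<rat> \<Longrightarrow> ((\<theta> 1 - \<theta> 3) - ?r * (\<theta> 2 - \<theta> 3)) / (2 * pi) \<in> \<rat> \<longleftrightarrow> ?X \<in> \<rat>"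
  proof (cases "cnj \<kappa> = \<kappa>")
    case True
    have "\<exists>k::int. multiplier i = cis (pi * of_int k)" for i using multiplier_real[OF True] PQS(4)[OF True] by blast
    then obtain k :: "3 \<Rightarrow> int" where k: "\<And>i. multiplier i = cis (pi * of_int (k i))" by metis
    \<comment> \<open>All multipliers are \<open>1\<close> or \<open>- 1\<close>, so all phases are multiples of \<open>\<pi>\<close>.\<close>
    have rat: "(of_int a - of_int b - r * (of_int c - of_int e)) / 2 \<in> \<rat>"
      if "r \<in> \<rat>" for r :: real and a b c e :: int
      using that by (intro Rats_divide Rats_diff Rats_mult Rats_of_int Rats_number_of)
    have "((pi * of_int (k 1) - pi * of_int (k 3)) - ?r * (pi * of_int (k 2) - pi * of_int (k 3))) / (2 * pi)
      = (of_int (k 1) - of_int (k 3) - ?r * (of_int (k 2) - of_int (k 3))) / 2"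
      by (simp add: divide_simps) (simp add: algebra_simps)
    hence "((pi * of_int (k 1) - pi * of_int (k 3)) - ?r * (pi * of_int (k 2) - pi * of_int (k 3))) / (2 * pi) \<in> \<rat>"
      if "?r \<in> \<rat>" using rat[OF that] by metis
    moreover have "?X \<in> \<rat>" using Im_beta2_real[OF True] by simp
    ultimately show thesis by (intro that[of "\<lambda>i. pi * of_int (k i)"] k) blast
  next
    case False
    obtain \<theta> where \<theta>: "\<And>i. multiplier i = cis (\<theta> i)"
      and lin: "\<forall>c :: 3 \<Rightarrow> real. (\<Sum>i\<in>UNIV. c i) = 0 \<longrightarrow> (\<Sum>i\<in>UNIV. c i * d i) = 0 \<longrightarrow>
        (\<Sum>i\<in>UNIV. c i * \<theta> i) = (\<Sum>i\<in>UNIV. c i * (d i)\<^sup>2) * ?B"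
      by (rule monodromy_phases[OF False], rule that, blast, blast)
    \<comment> \<open>Up to the factor \<open>d\<^sub>2 - d\<^sub>3\<close>, these are the coefficients of \<open>(\<theta>\<^sub>1 - \<theta>\<^sub>3) - r (\<theta>\<^sub>2 - \<theta>\<^sub>3)\<close>.\<close>
    define c where "c i = (vector [d\<^sub>2 - d\<^sub>3, d\<^sub>3 - d\<^sub>1, d\<^sub>1 - d\<^sub>2] :: real^3) $ i" for i
    have c: "c 1 = d\<^sub>2 - d\<^sub>3" "c 2 = d\<^sub>3 - d\<^sub>1" "c 3 = d\<^sub>1 - d\<^sub>2" by (simp_all add: c_def)
    have "(d\<^sub>2 - d\<^sub>3) * \<theta> 1 + (d\<^sub>3 - d\<^sub>1) * \<theta> 2 + (d\<^sub>1 - d\<^sub>2) * \<theta> 3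
      = ((d\<^sub>2 - d\<^sub>3) * d\<^sub>1\<^sup>2 + (d\<^sub>3 - d\<^sub>1) * d\<^sub>2\<^sup>2 + (d\<^sub>1 - d\<^sub>2) * d\<^sub>3\<^sup>2) * ?B"
      using lin[rule_format, of c] unfolding sum_3 c d by (simp add: algebra_simps)
    hence "(d\<^sub>2 - d\<^sub>3) * ((\<theta> 1 - \<theta> 3) - ?r * (\<theta> 2 - \<theta> 3)) = (d\<^sub>2 - d\<^sub>3) * ((d\<^sub>1 - d\<^sub>2) * (d\<^sub>1 - d\<^sub>3) * ?B)"
      using d23 by (simp add: right_diff_distrib power2_eq_square) (simp add: algebra_simps)
    hence 1: "(\<theta> 1 - \<theta> 3) - ?r * (\<theta> 2 - \<theta> 3) = (d\<^sub>1 - d\<^sub>2) * (d\<^sub>1 - d\<^sub>3) * ?B" using d23 by simp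
    have e: "(d\<^sub>1 - d\<^sub>2) * (d\<^sub>1 - d\<^sub>3) = (3 * (?r - 1)) * ((d\<^sub>1 - d\<^sub>3) * (d\<^sub>2 - d\<^sub>3) / 3)"
      using d23 by (simp add: field_simps)
    have "a * y * b / c = a * (b / c * y)" for a b c y :: real by simp
    hence 2: "((\<theta> 1 - \<theta> 3) - ?r * (\<theta> 2 - \<theta> 3)) / (2 * pi) = (3 * (?r - 1)) * ?X"
      unfolding 1 X e .
    have "3 * (?r - 1) \<noteq> 0" using d12 d23 by (simp add: field_simps)
    hence 3: "?X = ((\<theta> 1 - \<theta> 3) - ?r * (\<theta> 2 - \<theta> 3)) / (2 * pi) / (3 * (?r - 1))"
      unfolding 2 by (rule nonzero_mult_div_cancel_left[symmetric])
    have "3 * (?r - 1) \<in> \<rat>" if "?r \<in> \<rat>" using that by (intro Rats_mult Rats_diff Rats_number_of Rats_1)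
    hence "((\<theta> 1 - \<theta> 3) - ?r * (\<theta> 2 - \<theta> 3)) / (2 * pi) \<in> \<rat> \<longleftrightarrow> ?X \<in> \<rat>" if "?r \<in> \<rat>"
      using that 2 3 by (metis Rats_mult Rats_divide)
    with \<theta> that show thesis by blast
  qed
  show ?thesis
    unfolding assms(6) descends_iff[OF assms(5) PQS(5) \<theta>] d
      ratio_rational_iff_difference_ratio_rational[OF rel(1) d23]
    using link d12 by blast
qed

end
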